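(* Let $T$ be a finite directed tree (a tree with an orientation of each edge, such as the one induced by a labeling of its vertices). Then the chromatic quasisymmetric function $X_T(x;q)$ is symmetric if and only if $T$ is a directed path.
   Context: For a finite directed acyclic graph $G$ with vertex set $V$, a proper coloring is a map $\kappa:V\to\{1,2,3,\ldots\}$ taking distinct values on adjacent vertices; $\mathrm{asc}(\kappa)$ is the number of directed edges $(u,v)$ (from $u$ to $v$) with $\kappa(u)<\kappa(v)$. The chromatic quasisymmetric function is $X_G(x;q)=\sum_\kappa q^{\mathrm{asc}(\kappa)}\prod_{v\in V}x_{\kappa(v)}$, summed over all proper colorings; it is symmetric if it is invariant under all permutations of the variables $x_1,x_2,\ldots$. A vertex labeling by $1,\ldots,n$ induces the orientation in which each edge points from the smaller label to the larger. A directed path is a directed graph with vertices $v_1,\ldots,v_n$ whose edges are exactly $(v_i,v_{i+1})$ for $1\le i\le n-1$. *)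

theory Defs
  imports
    "Graph_Theory.Digraph_Component"
    "HOL-Library.Multiset"
    "HOL-Library.FuncSet"
    "HOL-Combinatorics.Permutations"
    "HOL-Computational_Algebra.Polynomial"
begin

text \<open>
  An oriented tree. The predicate \<^const>\<open>tree\<close> only excludes directed cycles, so it also holds,
  for example, of an acyclically oriented triangle. Here cycles are taken in the underlying
  undirected graph. In \<^const>\<open>mk_symmetric\<close> a single edge traversed back and forth is a cycle of
  length 2, so the cycles of the undirected graph are those of length at least 3.
  Connectedness includes that there is at least one vertex.
\<close>

locale directed_tree = pair_digraph +
  assumes oriented: "(u, v) \<in> parcs G \<Longrightarrow> (v, u) \<notin> parcs G"
    and underlying_connected: "connected (with_proj G)"
    and underlying_acyclic:
      "\<not> (\<exists>p. pre_digraph.cycle (with_proj (mk_symmetric (with_proj G))) p \<and> 3 \<le> length p)"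

definition directed_path :: "'a pair_pre_digraph \<Rightarrow> bool" where
  "directed_path G \<longleftrightarrow>
    (\<exists>vs. vs \<noteq> [] \<and> distinct vs \<and> pverts G = set vs \<and>
       parcs G = {(vs ! i, vs ! Suc i) | i. Suc i < length vs})"

definition proper_colorings :: "'a pair_pre_digraph \<Rightarrow> ('a \<Rightarrow> nat) set" where
  "proper_colorings G =
    {\<kappa> \<in> pverts G \<rightarrow>\<^sub>E {1..}. \<forall>(u, v) \<in> parcs G. \<kappa> u \<noteq> \<kappa> v}"

definition asc :: "'a pair_pre_digraph \<Rightarrow> ('a \<Rightarrow> nat) \<Rightarrow> nat" where
  "asc G \<kappa> = card {(u, v) \<in> parcs G. \<kappa> u < \<kappa> v}"

text \<open>
  The monomial \<open>x\<^sub>i \<cdots> x\<^sub>j\<close> is the multiset of its indices \<open>{#i, \<dots>, j#}\<close>, and a formal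
  power series over \<open>\<int>[q]\<close> in \<open>x\<^sub>1, x\<^sub>2, \<dots>\<close> is the function giving the coefficient of
  each monomial. Index 0 is not a variable: monomials involving it have coefficient 0.
\<close>

type_synonym power_series = "nat multiset \<Rightarrow> int poly"

definition coloring_monomial :: "'a pair_pre_digraph \<Rightarrow> ('a \<Rightarrow> nat) \<Rightarrow> nat multiset" where
  "coloring_monomial G \<kappa> = image_mset \<kappa> (mset_set (pverts G))"

definition chromatic_quasisymmetric :: "'a pair_pre_digraph \<Rightarrow> power_series" where
  "chromatic_quasisymmetric G =
    (\<lambda>m. \<Sum>\<kappa> | \<kappa> \<in> proper_colorings G \<and> coloring_monomial G \<kappa> = m. monom 1 (asc G \<kappa>))"

text \<open>The sums defining the coefficients are finite, so none of them is 0 by convention.\<close>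

lemma finite_colorings_with_monomial:
  assumes "finite (pverts G)"
  shows "finite {\<kappa>. \<kappa> \<in> proper_colorings G \<and> coloring_monomial G \<kappa> = m}"
proof (rule finite_subset)
  show "{\<kappa>. \<kappa> \<in> proper_colorings G \<and> coloring_monomial G \<kappa> = m}
    \<subseteq> pverts G \<rightarrow>\<^sub>E set_mset m"
    using assms by (auto simp: proper_colorings_def coloring_monomial_def PiE_iff extensional_def)
  show "finite (pverts G \<rightarrow>\<^sub>E set_mset m)"
    using assms by (intro finite_PiE) auto
qed

text \<open>
  Substituting \<open>x\<^sub>i \<mapsto> x\<^bsub>\<sigma> i\<^esub>\<close> sends the monomial \<open>m\<close> to \<open>image_mset \<sigma> m\<close>.
\<close>

definition symmetric_series :: "power_series \<Rightarrow> bool" where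
  "symmetric_series F \<longleftrightarrow>
    (\<forall>\<sigma>. \<sigma> permutes {1..} \<longrightarrow> (\<forall>m. F (image_mset \<sigma> m) = F m))"

end

theory Submission
  imports Defs
begin

text \<open>
  A coloring of a directed path is a word without equal neighbours, and \<open>asc\<close> is its number of
  ascents. Exchanging the letters \<open>c\<close> and \<open>c + 1\<close> in the maximal runs over \<open>{c, c + 1}\<close> of odd
  length (\<open>flip_odd_runs\<close>) is an involution. Such a run alternates, so a run of odd length has as many ascents as
  descents and keeps its number of ascents when exchanged, while a run of even length contains both
  letters equally often. Hence the involution preserves ascents and exchanges the exponents of
  \<open>x\<^sub>c\<close> and \<open>x\<^bsub>c+1\<^esub>\<close>; since adjacent transpositions generate, the series of a path is symmetric.

  Conversely, if the series of a tree is symmetric, then so is its coefficient of \<open>q\<^sup>e\<close>, where \<open>e\<close> is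
  the number of arcs. It counts the colorings that increase along every arc, which are the strictly
  order-preserving maps of the poset \<open>P\<close> given by reachability. The core of the proof is a fact about
  finite posets (\<open>symmetric_poset_union_of_chains\<close>): if the generating function of the strictly
  order-preserving maps of \<open>P\<close> is symmetric, then \<open>P\<close> is a disjoint union of chains.

  To see this, let \<open>M\<close> be the set of minimal elements of \<open>P\<close> and \<open>k = |M|\<close>. Every antichain is a color
  class of some coloring, and by symmetry its color may be taken to be the smallest one, whose class
  consists of minimal elements; so every antichain has at most \<open>k\<close> elements
  (\<open>symmetric_poset_width\<close>). The colorings that use the
  smallest color \<open>k\<close> times are the colorings of \<open>P - M\<close>, so \<open>P - M\<close> also has a symmetric generating
  function and is a disjoint union of chains by induction. Comparing the types \<open>(k, 1, \<dots>)\<close> and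
  \<open>(1, k, \<dots>)\<close> shows that the bottom of each of these chains lies above exactly one minimal element, and
  different bottoms lie above different ones (\<open>second_level_unique_lower\<close>,
  \<open>second_level_distinct_lower\<close>). Gluing each chain to the minimal element below it
  covers \<open>P\<close> by \<open>k\<close> chains. The disjoint union \<open>P'\<close> of these chains has a symmetric generating function
  too, every coloring of \<open>P\<close> is one of \<open>P'\<close>, and both posets have the same colorings that use the
  smallest color \<open>k\<close> times. By symmetry they have equally many, hence the same, colorings of every type
  in which some color is used \<open>k\<close> times (\<open>chain_cover_exhausts_relations\<close>). If
  \<open>y < x\<close> held in \<open>P\<close> for some \<open>x\<close>, \<open>y\<close> on different chains, then \<open>P'\<close> would have a coloring with \<open>k\<close>
  elements of one color, \<open>x\<close> and \<open>y\<close> among them, and this is not a coloring of \<open>P\<close>.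

  In a tree, connectedness then forces all vertices onto a single chain, and a relation \<open>u < w < v\<close>
  excludes the arc \<open>(u, v)\<close>, which would close a cycle (\<open>no_bypass\<close>). So the arcs join consecutive vertices.
\<close>

section \<open>Invariance under permutations of the variables\<close>

text \<open>
  The transposition of \<open>a\<close> and \<open>a + d + 1\<close> is the one of \<open>a\<close> and \<open>a + d\<close> conjugated by an adjacent
  transposition.
\<close>

lemma invariant_transposition:
  fixes F :: "nat multiset \<Rightarrow> 'b"
  assumes adj: "\<And>c m. F (image_mset (transpose c (Suc c)) m) = F m"
  shows "F (image_mset (transpose a b) m) = F m"
proof -
  have up: "F (image_mset (transpose a (a + d)) m) = F m" for a d m
  proof (induction d arbitrary: m)
    case (Suc d)
    show ?case
    proof (cases "d = 0")
      case False
      let ?s = "transpose (a + d) (Suc (a + d))"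
      have "transpose a (a + Suc d) = ?s \<circ> transpose a (a + d) \<circ> ?s"
        using False by (auto simp: transpose_def fun_eq_iff)
      then have "image_mset (transpose a (a + Suc d)) m
          = image_mset ?s (image_mset (transpose a (a + d)) (image_mset ?s m))"
        by (simp only: multiset.map_comp comp_assoc)
      then show ?thesis
        by (simp only: adj Suc.IH)
    qed (simp add: adj)
  qed simp
  show ?thesis
  proof (cases "a \<le> b")
    case True
    then show ?thesis using up[of a "b - a" m] by simp
  next
    case False
    then show ?thesis using up[of b "a - b" m] by (simp add: transpose_commute)
  qed
qed

lemma permutes_extending:
  assumes "finite S" "inj_on f S"
  obtains p where "p permutes (S \<union> f ` S)" "\<And>x. x \<in> S \<Longrightarrow> p x = f x"
proof -
  have "card (f ` S - S) = card (S - f ` S)"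
    using assms by (metis card_Diff_subset_Int card_image finite_Int finite_imageI inf_commute)
  then obtain g where g: "bij_betw g (f ` S - S) (S - f ` S)"
    using assms(1) by (meson finite_Diff finite_imageI finite_same_card_bij)
  define p where "p x = (if x \<in> S then f x else if x \<in> f ` S then g x else x)" for x
  have "bij_betw p S (f ` S)"
    using assms(2) by (auto simp: bij_betw_def p_def inj_on_def)
  moreover have "bij_betw p (f ` S - S) (S - f ` S)"
    using g by (rule bij_betw_cong[THEN iffD1, rotated]) (auto simp: p_def)
  ultimately have "bij_betw p (S \<union> (f ` S - S)) (f ` S \<union> (S - f ` S))"
    by (rule bij_betw_combine) auto
  then have "bij_betw p (S \<union> f ` S) (S \<union> f ` S)"
    by (simp add: Un_commute)
  then have "p permutes (S \<union> f ` S)"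
    by (rule bij_imp_permutes) (auto simp: p_def)
  then show ?thesis
    using that by (simp add: p_def)
qed

text \<open>
  An arbitrary permutation of the variables may move infinitely many of them, but a monomial sees only
  its values on a finite set, and there it agrees with a finite product of transpositions.
\<close>

lemma invariant_injection:
  fixes F :: "nat multiset \<Rightarrow> 'b"
  assumes adj: "\<And>c m. F (image_mset (transpose c (Suc c)) m) = F m"
    and "inj_on f (set_mset m)"
  shows "F (image_mset f m) = F m"
proof -
  obtain p where p: "p permutes (set_mset m \<union> f ` set_mset m)" and pf: "\<And>x. x \<in># m \<Longrightarrow> p x = f x"
    using permutes_extending[OF finite_set_mset assms(2)] by blast
  have fin: "finite (set_mset m \<union> f ` set_mset m)"
    by simp
  have "F (image_mset p m') = F m'" for m'
    using p fin
  proof (induction arbitrary: m' rule: permutes_induct)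
    case (swap a b p)
    have "F (image_mset (transpose a b \<circ> p) m') = F (image_mset (transpose a b) (image_mset p m'))"
      by (simp only: multiset.map_comp)
    then show ?case
      by (simp only: invariant_transposition[of F, OF adj] swap.IH)
  qed simp
  then show ?thesis
    using pf by (metis image_mset_cong)
qed

section \<open>Ascents and runs of words\<close>

definition ascents :: "nat list \<Rightarrow> nat" where
  "ascents w = length (filter (\<lambda>(x, y). x < y) (zip w (tl w)))"

lemma ascents_simps [simp]:
  "ascents [] = 0" "ascents [x] = 0"
  "ascents (x # y # w) = (if x < y then 1 else 0) + ascents (y # w)"
  by (simp_all add: ascents_def)

lemma ascents_append:
  "ascents (v @ w) = ascents v + ascents w
     + (if v \<noteq> [] \<and> w \<noteq> [] \<and> last v < hd w then 1 else 0)"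
proof (induction v rule: induct_list012)
  case (2 x)
  then show ?case by (cases w) auto
qed auto

definition flip_run :: "nat \<Rightarrow> nat list \<Rightarrow> nat list" where
  "flip_run c r = (if odd (length r) then map (transpose c (Suc c)) r else r)"

lemma flip_run_eq_Nil [simp]: "flip_run c r = [] \<longleftrightarrow> r = []"
  by (simp add: flip_run_def)

lemma set_flip_run: "set r \<subseteq> {c, Suc c} \<Longrightarrow> set (flip_run c r) \<subseteq> {c, Suc c}"
  by (auto simp: flip_run_def transpose_def)

lemma flip_run_flip_run [simp]: "flip_run c (flip_run c r) = r"
  by (simp add: flip_run_def comp_def)

lemma distinct_adj_flip_run: "distinct_adj r \<Longrightarrow> distinct_adj (flip_run c r)"
  unfolding flip_run_def by (auto intro!: distinct_adj_mapI inj_on_subset[OF inj_on_transpose])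

text \<open>
  A run without equal neighbours over two letters alternates, so it can be consumed two letters at a
  time: a letter and its mirror image, after which the same letter comes again.
\<close>

lemma run_induct [consumes 2, case_names Nil single step]:
  assumes "set r \<subseteq> {c, Suc c}" "distinct_adj r"
    and "P []" "\<And>x. x \<in> {c, Suc c} \<Longrightarrow> P [x]"
    and "\<And>x r. x \<in> {c, Suc c} \<Longrightarrow> r = [] \<or> hd r = x \<Longrightarrow> P r
           \<Longrightarrow> P (x # transpose c (Suc c) x # r)"
  shows "P r"
  using assms(1,2)
proof (induction r rule: induct_list012)
  case (3 x y r)
  then have y: "y = transpose c (Suc c) x"
    by (auto simp: transpose_def)
  have "r = [] \<or> hd r = x"
    using 3(3,4) by (cases r) (auto simp: transpose_def)
  moreover have "P r"
    using 3 by (auto dest: distinct_adj_ConsD)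
  ultimately show ?case
    unfolding y using 3(3) by (intro assms(5)) auto
qed (use assms in auto)

text \<open>
  An even run contains both letters equally often, so that leaving it alone has the same effect on
  its content as exchanging the letters.
\<close>

lemma mset_flip_run:
  assumes "set r \<subseteq> {c, Suc c}" "distinct_adj r"
  shows "mset (flip_run c r) = image_mset (transpose c (Suc c)) (mset r)"
proof (cases "even (length r)")
  case True
  have "even (length r) \<Longrightarrow> mset r = image_mset (transpose c (Suc c)) (mset r)"
    using assms by (induction rule: run_induct) auto
  then show ?thesis using True by (simp add: flip_run_def)
qed (simp add: flip_run_def)

text \<open>
  Ascents and descents alternate in a run. An odd run has an even number of steps, hence equally many
  of both, and exchanging the letters turns ascents into descents.
\<close>

lemma ascents_flip_run:
  assumes "set r \<subseteq> {c, Suc c}" "distinct_adj r"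
  shows "ascents (flip_run c r) = ascents r"
proof (cases "odd (length r)")
  case True
  have "odd (length r) \<Longrightarrow> ascents (map (transpose c (Suc c)) r) = ascents r"
    using assms
  proof (induction rule: run_induct)
    case (step x r)
    then obtain r' where "r = x # r'"
      by (cases r) auto
    with step show ?case by (auto simp: transpose_def)
  qed auto
  then show ?thesis using True by (simp add: flip_run_def)
qed (simp add: flip_run_def)

function flip_odd_runs :: "nat \<Rightarrow> nat list \<Rightarrow> nat list" where
  "flip_odd_runs c w =
     flip_run c (takeWhile (\<lambda>x. x \<in> {c, Suc c}) w) @
     (case dropWhile (\<lambda>x. x \<in> {c, Suc c}) w of [] \<Rightarrow> [] | x # u \<Rightarrow> x # flip_odd_runs c u)"
  by auto
termination
proof (relation "measure (\<lambda>(c, w). length w)", goal_cases)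
  case (2 c w x u)
  then show ?case
    using length_dropWhile_le[of "\<lambda>x. x \<in> {c, Suc c}" w] by simp
qed simp

declare flip_odd_runs.simps [simp del]

lemma flip_odd_runs_run:
  "set r \<subseteq> {c, Suc c} \<Longrightarrow> flip_odd_runs c r = flip_run c r"
  by (subst flip_odd_runs.simps) (auto simp: takeWhile_eq_all_conv[THEN iffD2] dropWhile_eq_Nil_conv[THEN iffD2] subset_iff)

lemma flip_odd_runs_step:
  assumes "set r \<subseteq> {c, Suc c}" "x \<notin> {c, Suc c}"
  shows "flip_odd_runs c (r @ x # u) = flip_run c r @ x # flip_odd_runs c u"
proof -
  have "\<forall>y\<in>set r. y \<in> {c, Suc c}"
    using assms(1) by blast
  then show ?thesis
    using assms(2) by (subst flip_odd_runs.simps) (simp add: takeWhile_append dropWhile_append)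
qed

lemma runs_induct [case_names run step]:
  assumes "\<And>r. set r \<subseteq> {c, Suc c} \<Longrightarrow> P r"
    and "\<And>r x u. set r \<subseteq> {c, Suc c} \<Longrightarrow> x \<notin> {c, Suc c} \<Longrightarrow> P u \<Longrightarrow> P (r @ x # u)"
  shows "P w"
proof (induction w rule: length_induct)
  case (1 w)
  let ?p = "\<lambda>x. x \<in> {c, Suc c}"
  have r: "set (takeWhile ?p w) \<subseteq> {c, Suc c}"
    by (auto dest: set_takeWhileD)
  show ?case
  proof (cases "dropWhile ?p w")
    case Nil
    then have "takeWhile ?p w = w"
      by (metis append_Nil2 takeWhile_dropWhile_id)
    then show ?thesis using assms(1)[OF r] by (simp only:)
  next
    case (Cons x u)
    then have w: "w = takeWhile ?p w @ x # u"
      using takeWhile_dropWhile_id[of ?p w] by simp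
    have "\<not> ?p x"
      using Cons by (simp add: dropWhile_eq_Cons_conv)
    moreover have "P u"
      using 1 length_dropWhile_le[of ?p w] Cons by simp
    ultimately show ?thesis
      using assms(2)[OF r] w by metis
  qed
qed

lemma flip_odd_runs_flip_odd_runs [simp]: "flip_odd_runs c (flip_odd_runs c w) = w"
  by (induction w rule: runs_induct[of c])
     (simp_all add: flip_odd_runs_run flip_odd_runs_step set_flip_run del: insert_iff)

lemma flip_odd_runs_eq_Nil [simp]: "flip_odd_runs c w = [] \<longleftrightarrow> w = []"
  by (metis flip_odd_runs_flip_odd_runs flip_odd_runs_run empty_subsetI empty_set flip_run_eq_Nil)

text \<open>
  No letter lies strictly between \<open>c\<close> and \<open>c + 1\<close>. This is why only adjacent letters can be
  exchanged: at the border of a run, the comparison with the neighbouring letter survives.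
\<close>

lemma order_transpose_adjacent:
  assumes "x \<notin> {c, Suc c}"
  shows "x < transpose c (Suc c) y \<longleftrightarrow> x < y" "transpose c (Suc c) y < x \<longleftrightarrow> y < x"
    "x = transpose c (Suc c) y \<longleftrightarrow> x = y"
  using assms by (auto simp: transpose_def)

lemma hd_last_flip_run:
  assumes "r \<noteq> []"
  shows "hd (flip_run c r) = hd r \<or> hd (flip_run c r) = transpose c (Suc c) (hd r)"
    "last (flip_run c r) = last r \<or> last (flip_run c r) = transpose c (Suc c) (last r)"
  using assms by (simp_all add: flip_run_def hd_map last_map)

lemma hd_flip_odd_runs:
  assumes "w \<noteq> []"
  shows "hd (flip_odd_runs c w) = hd w \<or> hd (flip_odd_runs c w) = transpose c (Suc c) (hd w)"
  using assms
proof (induction w rule: runs_induct[of c])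
  case (run r)
  then show ?case using hd_last_flip_run by (simp add: flip_odd_runs_run)
next
  case (step r x u)
  show ?case
    unfolding flip_odd_runs_step[OF step(1,2)]
    using hd_last_flip_run(1)[of r c] by (cases "r = []") (simp_all add: flip_run_def)
qed

lemma flip_odd_runs_preserves:
  assumes "distinct_adj w"
  shows "distinct_adj (flip_odd_runs c w)"
    and "ascents (flip_odd_runs c w) = ascents w"
    and "mset (flip_odd_runs c w) = image_mset (transpose c (Suc c)) (mset w)"
proof -
  have "distinct_adj (flip_odd_runs c w) \<and> ascents (flip_odd_runs c w) = ascents w \<and>
    mset (flip_odd_runs c w) = image_mset (transpose c (Suc c)) (mset w)"
    using assms
  proof (induction w rule: runs_induct[of c])
    case (run r)
    then show ?case
      by (simp add: flip_odd_runs_run distinct_adj_flip_run ascents_flip_run mset_flip_run)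
  next
    case (step r x u)
    note x = order_transpose_adjacent[OF step(2)]
    have r: "distinct_adj r" and u: "distinct_adj u"
      and rx: "r \<noteq> [] \<Longrightarrow> last r \<noteq> x" and xu: "u \<noteq> [] \<Longrightarrow> x \<noteq> hd u"
      using step(4) by (auto simp: distinct_adj_append_iff distinct_adj_Cons)
    have hd: "x \<noteq> hd (flip_odd_runs c u)" "x < hd (flip_odd_runs c u) \<longleftrightarrow> x < hd u" if "u \<noteq> []"
      using hd_flip_odd_runs[OF that, of c] x xu[OF that] by metis+
    have last: "last (flip_run c r) \<noteq> x" "last (flip_run c r) < x \<longleftrightarrow> last r < x" if "r \<noteq> []"
      using hd_last_flip_run(2)[OF that, of c] x rx[OF that] by metis+
    have fix_x: "transpose c (Suc c) x = x"
      using step(2) by (simp add: transpose_def)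
    have asc: "ascents (x # v) = ascents v + (if v \<noteq> [] \<and> x < hd v then 1 else 0)" for v
      by (cases v) auto
    note IH = step(3)[OF u]
    have "distinct_adj (flip_run c r @ x # flip_odd_runs c u)"
      using IH r hd(1) last(1) by (auto simp: distinct_adj_append_iff distinct_adj_Cons distinct_adj_flip_run)
    moreover have "ascents (flip_run c r @ x # flip_odd_runs c u) = ascents (r @ x # u)"
      using IH hd(2) last(2) ascents_flip_run[OF step(1) r]
      by (cases "r = []"; cases "u = []") (simp_all add: ascents_append asc)
    moreover have "mset (flip_run c r @ x # flip_odd_runs c u)
        = image_mset (transpose c (Suc c)) (mset (r @ x # u))"
      using IH by (simp add: mset_flip_run[OF step(1) r] fix_x)
    ultimately show ?case
      by (simp only: flip_odd_runs_step[OF step(1,2)])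
  qed
  then show "distinct_adj (flip_odd_runs c w)" "ascents (flip_odd_runs c w) = ascents w"
    "mset (flip_odd_runs c w) = image_mset (transpose c (Suc c)) (mset w)"
    by auto
qed

text \<open>
  The coefficients, by content, of the words without equal neighbours weighted by \<open>q\<close> to the number
  of ascents; up to the range of the variables and the length of the words this is the series of a
  directed path.
\<close>

definition path_series :: power_series where
  "path_series m = (\<Sum>w | distinct_adj w \<and> mset w = m. monom 1 (ascents w))"

lemma path_series_adjacent: "path_series (image_mset (transpose c (Suc c)) m) = path_series m"
  unfolding path_series_def
proof (rule sum.reindex_bij_witness[where i = "flip_odd_runs c" and j = "flip_odd_runs c"])
  show "flip_odd_runs c w \<in> {w. distinct_adj w \<and> mset w = m}"
    if "w \<in> {w. distinct_adj w \<and> mset w = image_mset (transpose c (Suc c)) m}" for w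
    using that by (auto simp: flip_odd_runs_preserves multiset.map_comp comp_def)
qed (auto simp: flip_odd_runs_preserves)

lemma path_series_symmetric:
  assumes "inj_on f (set_mset m)"
  shows "path_series (image_mset f m) = path_series m"
  using path_series_adjacent assms by (rule invariant_injection)

section \<open>Increasing colorings of a finite poset\<close>

definition increasing_colorings :: "('a \<times> 'a) set \<Rightarrow> 'a set \<Rightarrow> ('a \<Rightarrow> nat) set" where
  "increasing_colorings r V = {\<kappa> \<in> V \<rightarrow>\<^sub>E UNIV. \<forall>u\<in>V. \<forall>v\<in>V. (u, v) \<in> r \<longrightarrow> \<kappa> u < \<kappa> v}"

text \<open>
  In the poset part colors start at 0, so that the smallest color is also the smallest natural
  number and arbitrary permutations of \<open>nat\<close> act.
\<close>

definition type_on :: "'a set \<Rightarrow> ('a \<Rightarrow> nat) \<Rightarrow> nat multiset" where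
  "type_on V \<kappa> = image_mset \<kappa> (mset_set V)"

definition colorings_of_type :: "('a \<times> 'a) set \<Rightarrow> 'a set \<Rightarrow> nat multiset \<Rightarrow> ('a \<Rightarrow> nat) set" where
  "colorings_of_type r V m = {\<kappa> \<in> increasing_colorings r V. type_on V \<kappa> = m}"

definition symmetric_poset :: "('a \<times> 'a) set \<Rightarrow> 'a set \<Rightarrow> bool" where
  "symmetric_poset r V \<longleftrightarrow> (\<forall>\<sigma> m. bij \<sigma> \<longrightarrow>
     card (colorings_of_type r V (image_mset \<sigma> m)) = card (colorings_of_type r V m))"

definition minimal_elements :: "('a \<times> 'a) set \<Rightarrow> 'a set \<Rightarrow> 'a set" where
  "minimal_elements r V = {v \<in> V. \<forall>u\<in>V. (u, v) \<notin> r}"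

definition antichain :: "('a \<times> 'a) set \<Rightarrow> 'a set \<Rightarrow> bool" where
  "antichain r A \<longleftrightarrow> (\<forall>u\<in>A. \<forall>v\<in>A. (u, v) \<notin> r)"

definition comparable :: "('a \<times> 'a) set \<Rightarrow> 'a \<Rightarrow> 'a \<Rightarrow> bool" where
  "comparable r u v \<longleftrightarrow> u = v \<or> (u, v) \<in> r \<or> (v, u) \<in> r"

definition union_of_chains :: "('a \<times> 'a) set \<Rightarrow> 'a set \<Rightarrow> bool" where
  "union_of_chains r V \<longleftrightarrow>
     (\<forall>u\<in>V. \<forall>v\<in>V. \<forall>w\<in>V. comparable r u v \<longrightarrow> comparable r v w \<longrightarrow> comparable r u w)"

lemma comparable_refl [simp]: "comparable r v v"
  by (simp add: comparable_def)

lemma comparable_sym: "comparable r u v \<Longrightarrow> comparable r v u"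
  by (auto simp: comparable_def)

lemma union_of_chainsD:
  "union_of_chains r V \<Longrightarrow> u \<in> V \<Longrightarrow> v \<in> V \<Longrightarrow> w \<in> V \<Longrightarrow>
     comparable r u v \<Longrightarrow> comparable r v w \<Longrightarrow> comparable r u w"
  unfolding union_of_chains_def by blast

lemma increasing_coloringsD:
  "\<kappa> \<in> increasing_colorings r V \<Longrightarrow> u \<in> V \<Longrightarrow> v \<in> V \<Longrightarrow> (u, v) \<in> r \<Longrightarrow> \<kappa> u < \<kappa> v"
  by (auto simp: increasing_colorings_def)

lemma restrict_increasing:
  "(\<And>u v. u \<in> V \<Longrightarrow> v \<in> V \<Longrightarrow> (u, v) \<in> r \<Longrightarrow> f u < f v) \<Longrightarrow> restrict f V \<in> increasing_colorings r V"
  by (auto simp: increasing_colorings_def)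

lemma colorings_of_typeI:
  "\<kappa> \<in> increasing_colorings r V \<Longrightarrow> \<kappa> \<in> colorings_of_type r V (type_on V \<kappa>)"
  by (simp add: colorings_of_type_def)

lemma finite_colorings_of_type:
  assumes "finite V"
  shows "finite (colorings_of_type r V m)"
proof (rule finite_subset)
  show "colorings_of_type r V m \<subseteq> V \<rightarrow>\<^sub>E set_mset m"
    using assms by (auto simp: colorings_of_type_def increasing_colorings_def type_on_def PiE_iff extensional_def)
  show "finite (V \<rightarrow>\<^sub>E set_mset m)"
    using assms by (intro finite_PiE) auto
qed

lemma count_type_on:
  assumes "finite V"
  shows "count (type_on V \<kappa>) c = card {v \<in> V. \<kappa> v = c}"
proof -
  have "count (type_on V \<kappa>) c = (\<Sum>v | v \<in> V \<and> c = \<kappa> v. count (mset_set V) v)"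
    using assms by (simp add: type_on_def count_image_mset')
  also have "\<dots> = card {v \<in> V. c = \<kappa> v}"
    by (subst sum.cong[OF refl, where h = "\<lambda>_. 1"]) (auto simp: assms)
  finally show ?thesis
    by (simp add: eq_commute)
qed

lemma type_on_restrict [simp]: "finite V \<Longrightarrow> type_on V (restrict f V) = type_on V f"
  unfolding type_on_def by (rule image_mset_cong) simp

lemma type_on_comp: "type_on V (\<lambda>v. f (\<kappa> v)) = image_mset f (type_on V \<kappa>)"
  by (simp add: type_on_def multiset.map_comp comp_def)

lemma symmetric_posetD:
  "symmetric_poset r V \<Longrightarrow> bij \<sigma> \<Longrightarrow>
     card (colorings_of_type r V (image_mset \<sigma> m)) = card (colorings_of_type r V m)"
  by (simp add: symmetric_poset_def)

text \<open>
  The way in which symmetry is used to produce colorings: the colors of a given coloring may be renamed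
  by any permutation, at the price of rearranging which vertices get them.
\<close>

lemma symmetric_poset_moved_coloring:
  assumes "finite V" "symmetric_poset r V" "bij \<sigma>" "\<kappa> \<in> increasing_colorings r V"
  obtains \<kappa>' where "\<kappa>' \<in> increasing_colorings r V" "type_on V \<kappa>' = image_mset \<sigma> (type_on V \<kappa>)"
proof -
  have "card (colorings_of_type r V (type_on V \<kappa>)) \<noteq> 0"
    using finite_colorings_of_type[OF assms(1)] colorings_of_typeI[OF assms(4)]
    by (auto simp: card_eq_0_iff)
  then have "colorings_of_type r V (image_mset \<sigma> (type_on V \<kappa>)) \<noteq> {}"
    using symmetric_posetD[OF assms(2,3)] by (metis card.empty)
  then show ?thesis
    using that by (auto simp: colorings_of_type_def)
qed

lemma count_image_mset_bij:
  assumes "bij \<sigma>"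
  shows "count (image_mset \<sigma> m) (\<sigma> c) = count m c"
proof -
  have "{x \<in> set_mset m. \<sigma> c = \<sigma> x} = (if c \<in># m then {c} else {})"
    using assms by (auto simp: bij_is_inj inj_eq)
  then show ?thesis
    by (simp add: count_image_mset' not_in_iff)
qed

section \<open>Disjoint unions of chains\<close>

text \<open>
  On a disjoint union of chains, a color class meets every chain at most once. The involution exchanging
  \<open>c\<close> and \<open>c + 1\<close> therefore looks at whether the chain of \<open>v\<close> contains both colors (then nothing
  changes) or only one (then it is replaced by the other). Every color different from \<open>c\<close> and \<open>c + 1\<close>
  is its own image, so that its bearers are their own partners and are left alone as well.
\<close>

definition has_partner :: "('a \<times> 'a) set \<Rightarrow> 'a set \<Rightarrow> nat \<Rightarrow> ('a \<Rightarrow> nat) \<Rightarrow> 'a \<Rightarrow> bool" where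
  "has_partner r V c \<kappa> v \<longleftrightarrow> (\<exists>w\<in>V. comparable r v w \<and> \<kappa> w = transpose c (Suc c) (\<kappa> v))"

definition flip_unpaired :: "('a \<times> 'a) set \<Rightarrow> 'a set \<Rightarrow> nat \<Rightarrow> ('a \<Rightarrow> nat) \<Rightarrow> 'a \<Rightarrow> nat" where
  "flip_unpaired r V c \<kappa> =
     restrict (\<lambda>v. if has_partner r V c \<kappa> v then \<kappa> v else transpose c (Suc c) (\<kappa> v)) V"

lemma has_partnerI:
  "w \<in> V \<Longrightarrow> comparable r v w \<Longrightarrow> \<kappa> w = transpose c (Suc c) (\<kappa> v) \<Longrightarrow> has_partner r V c \<kappa> v"
  unfolding has_partner_def by blast

lemma has_partner_partner:
  "v \<in> V \<Longrightarrow> comparable r v w \<Longrightarrow> \<kappa> w = transpose c (Suc c) (\<kappa> v) \<Longrightarrow> has_partner r V c \<kappa> w"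
  by (rule has_partnerI[of v]) (simp_all add: comparable_sym[of r v w])

lemma flip_unpaired_apply:
  "v \<in> V \<Longrightarrow> flip_unpaired r V c \<kappa> v
     = (if has_partner r V c \<kappa> v then \<kappa> v else transpose c (Suc c) (\<kappa> v))"
  by (simp add: flip_unpaired_def)

lemma comparable_same_color:
  assumes "\<kappa> \<in> increasing_colorings r V" "u \<in> V" "v \<in> V" "comparable r u v" "\<kappa> u = \<kappa> v"
  shows "u = v"
  using assms by (auto simp: comparable_def dest: increasing_coloringsD)

lemma flip_unpaired_increasing:
  assumes "\<kappa> \<in> increasing_colorings r V"
  shows "flip_unpaired r V c \<kappa> \<in> increasing_colorings r V"
  unfolding flip_unpaired_def
proof (rule restrict_increasing)
  fix u v assume uv: "u \<in> V" "v \<in> V" "(u, v) \<in> r"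
  let ?s = "transpose c (Suc c)"
  have less: "\<kappa> u < \<kappa> v"
    using assms uv by (rule increasing_coloringsD)
  have cmp: "comparable r u v" "comparable r v u"
    using uv by (auto simp: comparable_def)
  show "(if has_partner r V c \<kappa> u then \<kappa> u else ?s (\<kappa> u))
      < (if has_partner r V c \<kappa> v then \<kappa> v else ?s (\<kappa> v))"
  proof (cases "\<kappa> v = ?s (\<kappa> u)")
    case True
    then have "has_partner r V c \<kappa> u" "has_partner r V c \<kappa> v"
      using uv cmp by (blast intro: has_partnerI has_partner_partner)+
    then show ?thesis
      using less by simp
  next
    case False
    then have "\<not> (\<kappa> u = c \<and> \<kappa> v = Suc c)"
      by auto
    with less have "\<kappa> u < \<kappa> v" "?s (\<kappa> u) < \<kappa> v" "\<kappa> u < ?s (\<kappa> v)" "?s (\<kappa> u) < ?s (\<kappa> v)"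
      by (auto simp: transpose_def)
    then show ?thesis
      by simp
  qed
qed

lemma has_partner_flip_unpaired:
  assumes chains: "union_of_chains r V" and v: "v \<in> V"
  shows "has_partner r V c (flip_unpaired r V c \<kappa>) v \<longleftrightarrow> has_partner r V c \<kappa> v"
proof
  let ?s = "transpose c (Suc c)" and ?f = "flip_unpaired r V c \<kappa>"
  assume paired: "has_partner r V c \<kappa> v"
  then obtain w where w: "w \<in> V" "comparable r v w" "\<kappa> w = ?s (\<kappa> v)"
    unfolding has_partner_def by blast
  then have "?f w = \<kappa> w"
    using has_partner_partner[of v V r w \<kappa> c] v by (simp add: flip_unpaired_apply)
  then show "has_partner r V c ?f v"
    using w v paired by (intro has_partnerI[of w]) (simp_all add: flip_unpaired_apply)
next
  let ?s = "transpose c (Suc c)" and ?f = "flip_unpaired r V c \<kappa>"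
  assume "has_partner r V c ?f v"
  then obtain w where w: "w \<in> V" "comparable r v w" "?f w = ?s (?f v)"
    unfolding has_partner_def by blast
  show "has_partner r V c \<kappa> v"
  proof (rule ccontr)
    assume unpaired: "\<not> has_partner r V c \<kappa> v"
    then have fw: "?f w = \<kappa> v"
      using w(3) v by (simp add: flip_unpaired_apply)
    show False
    proof (cases "has_partner r V c \<kappa> w")
      case True
      then obtain w' where w': "w' \<in> V" "comparable r w w'" "\<kappa> w' = ?s (\<kappa> w)"
        unfolding has_partner_def by blast
      have "\<kappa> w = \<kappa> v"
        using True fw w(1) by (simp add: flip_unpaired_apply)
      moreover have "comparable r v w'"
        using union_of_chainsD[OF chains v w(1) w'(1) w(2) w'(2)] .
      ultimately show False
        using unpaired w'(1,3) has_partnerI[of w' V r v \<kappa> c] by simp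
    next
      case False
      then have "?s (\<kappa> w) = \<kappa> v"
        using fw w(1) by (simp add: flip_unpaired_apply)
      then have "\<kappa> w = ?s (\<kappa> v)"
        by (metis transpose_involutory)
      then show False
        using unpaired w(1,2) has_partnerI[of w V r v \<kappa> c] by simp
    qed
  qed
qed

lemma flip_unpaired_flip_unpaired:
  assumes chains: "union_of_chains r V" and \<kappa>: "\<kappa> \<in> increasing_colorings r V"
  shows "flip_unpaired r V c (flip_unpaired r V c \<kappa>) = \<kappa>"
proof (rule ext)
  fix v
  show "flip_unpaired r V c (flip_unpaired r V c \<kappa>) v = \<kappa> v"
  proof (cases "v \<in> V")
    case True
    have "has_partner r V c (flip_unpaired r V c \<kappa>) v \<longleftrightarrow> has_partner r V c \<kappa> v"
      by (rule has_partner_flip_unpaired[OF chains True])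
    then show ?thesis
      by (simp add: flip_unpaired_apply[OF True])
  next
    case False
    then show ?thesis
      using \<kappa> by (simp add: flip_unpaired_def increasing_colorings_def PiE_iff extensional_def)
  qed
qed

lemma type_on_split:
  assumes "finite V" "W \<subseteq> V"
  shows "type_on V f = type_on W f + type_on (V - W) f"
proof -
  have "mset_set (W \<union> (V - W)) = mset_set W + mset_set (V - W)"
    using assms finite_subset[OF assms(2,1)] by (intro mset_set_Union) auto
  moreover have "W \<union> (V - W) = V"
    using assms(2) by blast
  ultimately show ?thesis
    by (simp add: type_on_def)
qed

text \<open>
  On the elements without partner the colors are exchanged. The elements with partner keep theirs, but
  passing to the partner permutes them and exchanges their colors, so their content is already
  invariant.
\<close>

lemma type_on_flip_unpaired:
  assumes fin: "finite V" and chains: "union_of_chains r V" and \<kappa>: "\<kappa> \<in> increasing_colorings r V"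
  shows "type_on V (flip_unpaired r V c \<kappa>) = image_mset (transpose c (Suc c)) (type_on V \<kappa>)"
proof -
  let ?s = "transpose c (Suc c)" and ?f = "flip_unpaired r V c \<kappa>"
  \<comment> \<open>The elements with partner, and a choice \<open>\<pi>\<close> of partners.\<close>
  define P where "P = {v \<in> V. has_partner r V c \<kappa> v}"
  have PV: "P \<subseteq> V"
    unfolding P_def by blast
  then have finP: "finite P"
    using fin by (rule finite_subset)
  have "\<forall>v\<in>P. \<exists>w\<in>P. comparable r v w \<and> \<kappa> w = ?s (\<kappa> v)"
  proof
    fix v assume "v \<in> P"
    then obtain w where w: "v \<in> V" "w \<in> V" "comparable r v w" "\<kappa> w = ?s (\<kappa> v)"
      unfolding P_def has_partner_def by blast
    then have "w \<in> P"
      unfolding P_def using has_partner_partner[of v V r w \<kappa> c] by simp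
    then show "\<exists>w\<in>P. comparable r v w \<and> \<kappa> w = ?s (\<kappa> v)"
      using w by blast
  qed
  then obtain \<pi> where \<pi>: "\<And>v. v \<in> P \<Longrightarrow> \<pi> v \<in> P" "\<And>v. v \<in> P \<Longrightarrow> comparable r v (\<pi> v)"
      "\<And>v. v \<in> P \<Longrightarrow> \<kappa> (\<pi> v) = ?s (\<kappa> v)"
    by metis
  have inj: "inj_on \<pi> P"
  proof (rule inj_onI)
    fix u v assume uv: "u \<in> P" "v \<in> P" "\<pi> u = \<pi> v"
    then have "?s (\<kappa> u) = ?s (\<kappa> v)"
      using \<pi>(3) by metis
    then have "\<kappa> u = \<kappa> v"
      by (metis transpose_involutory)
    moreover have "comparable r u v"
    proof (rule union_of_chainsD[OF chains])
      show "comparable r u (\<pi> u)" "comparable r (\<pi> u) v"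
        using \<pi>(2)[OF uv(1)] comparable_sym[OF \<pi>(2)[OF uv(2)]] uv(3) by simp_all
    qed (use uv \<pi>(1) PV in blast)+
    ultimately show "u = v"
      using comparable_same_color[OF \<kappa>] uv PV by blast
  qed
  have "\<pi> ` P = P"
    using \<pi>(1) inj finP by (intro endo_inj_surj) auto
  then have "image_mset \<pi> (mset_set P) = mset_set P"
    using inj by (simp add: image_mset_mset_set)
  then have "type_on P \<kappa> = image_mset \<kappa> (image_mset \<pi> (mset_set P))"
    by (simp add: type_on_def)
  also have "\<dots> = image_mset ?s (type_on P \<kappa>)"
    unfolding type_on_def multiset.map_comp
    by (rule image_mset_cong) (use \<pi>(3) finP in simp)
  finally have "type_on P \<kappa> = image_mset ?s (type_on P \<kappa>)" .
  moreover have "type_on P ?f = type_on P \<kappa>"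
    unfolding type_on_def
    by (rule image_mset_cong) (use finP in \<open>simp add: flip_unpaired_def P_def\<close>)
  moreover have "type_on (V - P) ?f = image_mset ?s (type_on (V - P) \<kappa>)"
    unfolding type_on_def multiset.map_comp
    by (rule image_mset_cong) (use fin in \<open>simp add: flip_unpaired_def P_def\<close>)
  ultimately show ?thesis
    by (simp add: type_on_split[OF fin PV])
qed

lemma union_of_chains_symmetric:
  assumes fin: "finite V" and chains: "union_of_chains r V"
  shows "symmetric_poset r V"
proof -
  have adj: "card (colorings_of_type r V (image_mset (transpose c (Suc c)) m))
      = card (colorings_of_type r V m)" for c m
  proof (rule bij_betw_same_card, rule bij_betw_byWitness)
    let ?s = "transpose c (Suc c)" and ?f = "flip_unpaired r V c"
    have f: "?f \<kappa> \<in> colorings_of_type r V (image_mset ?s m')"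
      if "\<kappa> \<in> colorings_of_type r V m'" for \<kappa> m'
      using that flip_unpaired_increasing type_on_flip_unpaired[OF fin chains]
      by (auto simp: colorings_of_type_def)
    show "?f ` colorings_of_type r V m \<subseteq> colorings_of_type r V (image_mset ?s m)"
      using f by blast
    show "?f ` colorings_of_type r V (image_mset ?s m) \<subseteq> colorings_of_type r V m"
      using f[of _ "image_mset ?s m"] by (auto simp: multiset.map_comp comp_def)
  qed (auto simp: colorings_of_type_def flip_unpaired_flip_unpaired[OF chains])
  show ?thesis
    unfolding symmetric_poset_def
    using invariant_injection[of "\<lambda>m. card (colorings_of_type r V m)", OF adj]
    by (meson bij_is_inj inj_on_subset subset_UNIV)
qed

lemma colorings_of_typeD:
  assumes "\<kappa> \<in> colorings_of_type r V m"
  shows "\<kappa> \<in> increasing_colorings r V" "type_on V \<kappa> = m"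
  using assms unfolding colorings_of_type_def by blast+

section \<open>Antichains and minimal elements\<close>

definition number_below :: "('a \<times> 'a) set \<Rightarrow> 'a set \<Rightarrow> 'a \<Rightarrow> nat" where
  "number_below r V v = card {u \<in> V. (u, v) \<in> r}"

lemma number_below_less:
  assumes "finite V" "trans r" "irrefl r" "u \<in> V" "(u, v) \<in> r"
  shows "number_below r V u < number_below r V v"
  unfolding number_below_def
proof (rule psubset_card_mono)
  have "u \<in> {w \<in> V. (w, v) \<in> r} - {w \<in> V. (w, u) \<in> r}"
    using assms by (auto simp: irrefl_def)
  moreover have "{w \<in> V. (w, u) \<in> r} \<subseteq> {w \<in> V. (w, v) \<in> r}"
    using transD[OF assms(2) _ assms(5)] by auto
  ultimately show "{w \<in> V. (w, u) \<in> r} \<subset> {w \<in> V. (w, v) \<in> r}"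
    by auto
qed (use assms in auto)

lemma number_below_le: "finite V \<Longrightarrow> number_below r V v \<le> card V"
  unfolding number_below_def by (rule card_mono) auto

lemma minimal_below:
  assumes "finite V" "trans r" "irrefl r" "v \<in> V"
  shows "\<exists>u \<in> minimal_elements r V. u = v \<or> (u, v) \<in> r"
  using assms(4)
proof (induction "number_below r V v" arbitrary: v rule: less_induct)
  case less
  show ?case
  proof (cases "v \<in> minimal_elements r V")
    case False
    then obtain w where w: "w \<in> V" "(w, v) \<in> r"
      using less.prems by (auto simp: minimal_elements_def)
    then obtain u where "u \<in> minimal_elements r V" "u = w \<or> (u, w) \<in> r"
      using less.hyps number_below_less[OF assms(1-3)] by blast
    then show ?thesis
      using transD[OF assms(2) _ w(2)] w(2) by auto
  qed blast
qed

lemma zero_color_minimal: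
  "\<kappa> \<in> increasing_colorings r V \<Longrightarrow> v \<in> V \<Longrightarrow> \<kappa> v = 0 \<Longrightarrow> v \<in> minimal_elements r V"
  by (auto simp: minimal_elements_def dest: increasing_coloringsD)

text \<open>
  Any antichain can be made a full color class: color everything below it by small colors and
  everything else by large ones, in both cases along the number of smaller elements.
\<close>

lemma antichain_coloring:
  assumes "finite V" "trans r" "irrefl r" "A \<subseteq> V" "antichain r A"
  obtains \<kappa> c where "\<kappa> \<in> increasing_colorings r V" "{v \<in> V. \<kappa> v = c} = A"
proof
  let ?N = "Suc (card V)"
  let ?\<kappa> = "\<lambda>v. if v \<in> A then ?N else if \<exists>a\<in>A. (v, a) \<in> r then number_below r V v else Suc ?N + number_below r V v"
  show "restrict ?\<kappa> V \<in> increasing_colorings r V"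
  proof (rule restrict_increasing)
    fix u v assume uv: "u \<in> V" "v \<in> V" "(u, v) \<in> r"
    have "number_below r V u < number_below r V v" "number_below r V u \<le> card V"
      using number_below_less number_below_le assms uv by metis+
    moreover have "(u, a) \<in> r" if "(v, a) \<in> r" for a
      using transD[OF assms(2) uv(3) that] .
    ultimately show "?\<kappa> u < ?\<kappa> v"
      using uv assms(5) by (fastforce simp: antichain_def)
  qed
  have "?\<kappa> v = ?N \<longleftrightarrow> v \<in> A" for v
    using number_below_le[OF assms(1), of r v] by auto
  then show "{v \<in> V. restrict ?\<kappa> V v = ?N} = A"
    using assms(4) by auto
qed

text \<open>
  Take a coloring that has the antichain as a color class. By symmetry there is one whose smallest
  color is used equally often, and elements of the smallest color are minimal.
\<close>

lemma symmetric_poset_width: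
  assumes "finite V" "trans r" "irrefl r" "symmetric_poset r V" "A \<subseteq> V" "antichain r A"
  shows "card A \<le> card (minimal_elements r V)"
proof -
  obtain \<kappa> c where \<kappa>: "\<kappa> \<in> increasing_colorings r V" "{v \<in> V. \<kappa> v = c} = A"
    using antichain_coloring assms by metis
  obtain \<kappa>' where \<kappa>': "\<kappa>' \<in> increasing_colorings r V"
      "type_on V \<kappa>' = image_mset (transpose c 0) (type_on V \<kappa>)"
    using symmetric_poset_moved_coloring[OF assms(1,4) bij_transpose \<kappa>(1)] by metis
  have "card A = count (type_on V \<kappa>) c"
    using \<kappa>(2) assms(1) by (simp add: count_type_on)
  also have "\<dots> = count (type_on V \<kappa>') 0"
    using count_image_mset_bij[OF bij_transpose, of c 0 "type_on V \<kappa>" c] \<kappa>'(2) by simp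
  also have "\<dots> = card {v \<in> V. \<kappa>' v = 0}"
    using assms(1) by (rule count_type_on)
  also have "\<dots> \<le> card (minimal_elements r V)"
    using zero_color_minimal[OF \<kappa>'(1)] assms(1)
    by (intro card_mono) (auto simp: minimal_elements_def)
  finally show ?thesis .
qed

lemma minimal_elements_color_class:
  assumes "finite V" "\<kappa> \<in> increasing_colorings r V"
    and "count (type_on V \<kappa>) 0 = card (minimal_elements r V)"
  shows "{v \<in> V. \<kappa> v = 0} = minimal_elements r V"
  using assms zero_color_minimal[OF assms(2)]
  by (intro card_subset_eq) (auto simp: count_type_on minimal_elements_def)

text \<open>
  If the smallest color is used as often as there are minimal elements, its class is exactly the set of
  minimal elements, and nothing is left to satisfy between that set and the rest.
\<close>

lemma card_colorings_without_minimal: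
  fixes r :: "('a \<times> 'a) set"
  assumes fin: "finite V"
  defines "M \<equiv> minimal_elements r V"
  shows "card (colorings_of_type r (V - M) m)
       = card (colorings_of_type r V (image_mset Suc m + replicate_mset (card M) 0))"
proof -
  let ?h = "\<lambda>\<kappa>. restrict (\<lambda>v. if v \<in> M then 0 else Suc (\<kappa> v)) V"
  let ?g = "\<lambda>\<kappa>. restrict (\<lambda>v. \<kappa> v - 1 :: nat) (V - M)"
  let ?m = "image_mset Suc m + replicate_mset (card M) 0"
  have MV: "M \<subseteq> V"
    by (auto simp: M_def minimal_elements_def)
  then have finM: "finite M"
    using fin by (rule finite_subset)
  have typeM: "type_on M f = replicate_mset (card M) 0" if "\<And>v. v \<in> M \<Longrightarrow> f v = 0" for f
  proof -
    have "type_on M f = image_mset (\<lambda>_. 0) (mset_set M)"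
      unfolding type_on_def by (rule image_mset_cong) (use that finM in auto)
    then show ?thesis by (simp add: image_mset_const_eq)
  qed
  have zero: "\<kappa> v = 0 \<longleftrightarrow> v \<in> M" if "\<kappa> \<in> colorings_of_type r V ?m" "v \<in> V" for \<kappa> v
  proof -
    have "count ?m 0 = card M"
      by (simp add: count_image_mset')
    then have "{v \<in> V. \<kappa> v = 0} = M"
      using minimal_elements_color_class[OF fin, of \<kappa> r] that(1)
      by (simp add: colorings_of_type_def M_def)
    then show ?thesis using that(2) by blast
  qed
  have gh: "\<forall>\<kappa>\<in>colorings_of_type r (V - M) m. ?g (?h \<kappa>) = \<kappa>"
    using MV by (auto simp: colorings_of_type_def increasing_colorings_def fun_eq_iff PiE_iff extensional_def restrict_def)
  have hg: "\<forall>\<kappa>\<in>colorings_of_type r V ?m. ?h (?g \<kappa>) = \<kappa>"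
  proof (intro ballI ext)
    fix \<kappa> v assume \<kappa>: "\<kappa> \<in> colorings_of_type r V ?m"
    show "?h (?g \<kappa>) v = \<kappa> v"
    proof (cases "v \<in> V")
      case True
      then show ?thesis using zero[OF \<kappa> True] by auto
    next
      case False
      then show ?thesis
        using \<kappa> by (simp add: colorings_of_type_def increasing_colorings_def PiE_iff extensional_def)
    qed
  qed
  have h: "?h ` colorings_of_type r (V - M) m \<subseteq> colorings_of_type r V ?m"
  proof (rule image_subsetI)
    fix \<kappa> assume \<kappa>: "\<kappa> \<in> colorings_of_type r (V - M) m"
    have "?h \<kappa> \<in> increasing_colorings r V"
    proof (rule restrict_increasing)
      fix u v assume uv: "u \<in> V" "v \<in> V" "(u, v) \<in> r"
      then have "v \<notin> M"
        by (auto simp: M_def minimal_elements_def)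
      then show "(if u \<in> M then 0 else Suc (\<kappa> u)) < (if v \<in> M then 0 else Suc (\<kappa> v))"
        using \<kappa> uv by (auto simp: colorings_of_type_def dest: increasing_coloringsD)
    qed
    moreover have "type_on (V - M) (?h \<kappa>) = image_mset Suc (type_on (V - M) \<kappa>)"
      unfolding type_on_def multiset.map_comp by (rule image_mset_cong) (use fin in auto)
    moreover have "type_on M (?h \<kappa>) = replicate_mset (card M) 0"
      by (rule typeM) (use MV in auto)
    ultimately show "?h \<kappa> \<in> colorings_of_type r V ?m"
      using \<kappa> type_on_split[OF fin MV, of "?h \<kappa>"]
      by (simp only: colorings_of_type_def mem_Collect_eq add.commute)
  qed
  have g: "?g ` colorings_of_type r V ?m \<subseteq> colorings_of_type r (V - M) m"
  proof (rule image_subsetI)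
    fix \<kappa> assume \<kappa>: "\<kappa> \<in> colorings_of_type r V ?m"
    have "?g \<kappa> \<in> increasing_colorings r (V - M)"
    proof (rule restrict_increasing)
      fix u v assume uv: "u \<in> V - M" "v \<in> V - M" "(u, v) \<in> r"
      then have "\<kappa> u < \<kappa> v" "\<kappa> u \<noteq> 0"
        using \<kappa> zero[OF \<kappa>] by (auto simp: colorings_of_type_def dest: increasing_coloringsD)
      then show "\<kappa> u - 1 < \<kappa> v - 1"
        by simp
    qed
    moreover have "type_on (V - M) (?g \<kappa>) = m"
    proof -
      have "type_on M \<kappa> = replicate_mset (card M) 0"
        by (rule typeM) (use zero[OF \<kappa>] MV in auto)
      then have "type_on (V - M) \<kappa> = image_mset Suc m"
        using \<kappa> type_on_split[OF fin MV, of \<kappa>] by (auto simp: colorings_of_type_def)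
      then have "image_mset (\<lambda>x. x - 1) (type_on (V - M) \<kappa>) = m"
        by (simp add: multiset.map_comp comp_def)
      then show ?thesis
        using fin type_on_comp[of "V - M" "\<lambda>x. x - 1" \<kappa>] by simp
    qed
    ultimately show "?g \<kappa> \<in> colorings_of_type r (V - M) m"
      by (simp add: colorings_of_type_def)
  qed
  show ?thesis
    by (rule bij_betw_same_card[OF bij_betw_byWitness[OF gh hg h g]])
qed

lemma bij_case_nat_Suc: "bij \<sigma> \<Longrightarrow> bij (case_nat 0 (\<lambda>n. Suc (\<sigma> n)))"
  by (rule o_bij[of "case_nat 0 (\<lambda>n. Suc (inv \<sigma> n))"])
     (auto simp: fun_eq_iff bij_is_inj bij_is_surj surj_f_inv_f split: nat.split)

lemma symmetric_poset_without_minimal: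
  assumes "finite V" "symmetric_poset r V"
  shows "symmetric_poset r (V - minimal_elements r V)"
  unfolding symmetric_poset_def
proof (intro allI impI)
  fix \<sigma> :: "nat \<Rightarrow> nat" and m assume \<sigma>: "bij \<sigma>"
  let ?\<sigma> = "case_nat 0 (\<lambda>n. Suc (\<sigma> n))" and ?k = "card (minimal_elements r V)"
  have "image_mset Suc (image_mset \<sigma> m) + replicate_mset ?k 0
      = image_mset ?\<sigma> (image_mset Suc m + replicate_mset ?k 0)"
    by (simp add: multiset.map_comp comp_def)
  then show "card (colorings_of_type r (V - minimal_elements r V) (image_mset \<sigma> m))
      = card (colorings_of_type r (V - minimal_elements r V) m)"
    by (simp only: card_colorings_without_minimal[OF assms(1)]
        symmetric_posetD[OF assms(2) bij_case_nat_Suc[OF \<sigma>]])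
qed

section \<open>The elements directly above the minimal ones\<close>

text \<open>
  The class of color 1 has maximal size and follows a single element \<open>b\<close> of color 0. Its
  non-minimal elements lie above \<open>b\<close> only, so together with the minimal elements other than \<open>b\<close> they
  form an antichain; the bound on antichains leaves room for just one such element \<open>e\<close>.
\<close>

lemma almost_minimal_class:
  assumes V: "finite V" "trans r" "irrefl r" "symmetric_poset r V"
    and \<kappa>: "\<kappa> \<in> increasing_colorings r V"
    and zero: "card {v \<in> V. \<kappa> v = 0} = 1"
    and one: "card {v \<in> V. \<kappa> v = 1} = card (minimal_elements r V)"
  defines "M \<equiv> minimal_elements r V"
  obtains b e where "b \<in> M" "e \<in> V - M" "{v \<in> V. \<kappa> v = 0} = {b}"
    "{v \<in> V. \<kappa> v = 1} = insert e (M - {b})" "{u \<in> V. (u, e) \<in> r} = {b}"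
proof -
  define A where "A = {v \<in> V. \<kappa> v = 1}"
  obtain b where b: "{v \<in> V. \<kappa> v = 0} = {b}"
    using zero by (auto simp: card_1_singleton_iff)
  have bM: "b \<in> M"
    using b zero_color_minimal[OF \<kappa>] by (auto simp: M_def)
  have MV: "M \<subseteq> V" and finM: "finite M" and finA: "finite A"
    using V(1) by (auto simp: M_def A_def minimal_elements_def)
  have lower: "{u \<in> V. (u, e) \<in> r} = {b}" if e: "e \<in> A - M" for e
  proof
    show "{u \<in> V. (u, e) \<in> r} \<subseteq> {b}"
      using e b \<kappa> by (fastforce simp: A_def dest: increasing_coloringsD)
    then show "{b} \<subseteq> {u \<in> V. (u, e) \<in> r}"
      using e by (auto simp: A_def M_def minimal_elements_def)
  qed
  have bA: "b \<notin> A"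
    using b by (auto simp: A_def)
  have "card (A \<inter> M) \<le> card (M - {b})"
    using bA finM by (intro card_mono) auto
  then have AM: "card (A \<inter> M) < card M"
    using bM finM by (metis card_Diff1_less le_less_trans)
  have cardA: "card (A \<inter> M) + card (A - M) = card M"
    using one finA by (metis A_def M_def card_Int_Diff)
  have "antichain r ((M - {b}) \<union> (A - M))"
    unfolding antichain_def
  proof (intro ballI notI)
    fix u v assume u: "u \<in> M - {b} \<union> (A - M)" and v: "v \<in> M - {b} \<union> (A - M)" and uv: "(u, v) \<in> r"
    have uV: "u \<in> V" "v \<in> V"
      using u v MV by (auto simp: A_def)
    then have "v \<in> A - M"
      using v uv by (auto simp: M_def minimal_elements_def)
    then have "u = b"
      using lower uV uv by blast
    then show False
      using u bA by blast
  qed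
  moreover have "(M - {b}) \<union> (A - M) \<subseteq> V"
    using MV by (auto simp: A_def)
  ultimately have "card ((M - {b}) \<union> (A - M)) \<le> card M"
    using symmetric_poset_width[OF V] by (simp only: M_def)
  moreover have "card ((M - {b}) \<union> (A - M)) = card M - 1 + card (A - M)"
    using finM finA bM by (subst card_Un_disjoint) auto
  ultimately have "card (A - M) = 1"
    using AM cardA by linarith
  then obtain e where e: "A - M = {e}"
    by (auto simp: card_1_singleton_iff)
  have "A \<inter> M = M - {b}"
    using bA bM finM cardA \<open>card (A - M) = 1\<close> by (intro card_subset_eq) auto
  then have "A = insert e (M - {b})"
    using e by blast
  moreover have "e \<in> V - M" "{u \<in> V. (u, e) \<in> r} = {b}"
    using e lower[of e] by (auto simp: A_def)
  ultimately show ?thesis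
    using that bM b unfolding A_def by metis
qed

text \<open>
  Recoloring the class of \<open>almost_minimal_class\<close> so that all minimal elements get color 0 and \<open>e\<close>
  gets color 1 loses no information, because \<open>b\<close> is recovered as the only element below \<open>e\<close>. This
  injects the colorings of type \<open>(1, k, \<dots>)\<close> into those of type \<open>(k, 1, \<dots>)\<close>, and its image consists of
  colorings whose element of color 1 has a unique lower element. By symmetry both sets have the same
  size, so every coloring of the second type has this property. For any \<open>c\<close> minimal above the minimal
  elements there is such a coloring in which \<open>c\<close> has color 1.
\<close>

lemma second_level_unique_lower:
  assumes V: "finite V" "trans r" "irrefl r" "symmetric_poset r V"
  defines "M \<equiv> minimal_elements r V"
  assumes c: "c \<in> minimal_elements r (V - M)"
  shows "\<exists>b. {u \<in> V. (u, c) \<in> r} = {b}"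
proof -
  let ?s = "transpose 0 1 :: nat \<Rightarrow> nat"
  \<comment> \<open>A coloring of type \<open>(k, 1, \<dots>)\<close> in which \<open>c\<close> has color 1.\<close>
  define \<kappa>0 where "\<kappa>0 = restrict (\<lambda>v. if v \<in> M then 0 else if v = c then 1 else 2 + number_below r V v) V"
  define m where "m = type_on V \<kappa>0"
  have MV: "M \<subseteq> V" and cV: "c \<in> V - M"
    using c by (auto simp: M_def minimal_elements_def)
  have \<kappa>0: "\<kappa>0 \<in> increasing_colorings r V"
    unfolding \<kappa>0_def
  proof (rule restrict_increasing)
    fix u v assume uv: "u \<in> V" "v \<in> V" "(u, v) \<in> r"
    have "v \<notin> M"
      using uv by (auto simp: M_def minimal_elements_def)
    moreover have "u \<in> M" if "v = c"
      using that c uv by (auto simp: minimal_elements_def)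
    moreover have "number_below r V u < number_below r V v"
      using number_below_less[OF V(1-3)] uv by blast
    ultimately show "(if u \<in> M then 0 else if u = c then 1 else 2 + number_below r V u)
        < (if v \<in> M then 0 else if v = c then 1 else 2 + number_below r V v)"
      by auto
  qed
  have m0: "count m 0 = card M"
  proof -
    have "{v \<in> V. \<kappa>0 v = 0} = M"
      using MV by (auto simp: \<kappa>0_def)
    then show ?thesis using V(1) by (simp add: m_def count_type_on)
  qed
  have m1: "count m 1 = 1"
  proof -
    have "{v \<in> V. \<kappa>0 v = 1} = {c}"
      using cV by (auto simp: \<kappa>0_def)
    then show ?thesis using V(1) by (simp add: m_def count_type_on)
  qed
  define h where "h \<kappa> = restrict (\<lambda>v. if v \<in> M then 0 else if \<kappa> v \<le> (1::nat) then 1 else \<kappa> v) V" for \<kappa>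
  let ?C = "colorings_of_type r V (image_mset ?s m)"
  \<comment> \<open>What \<open>almost_minimal_class\<close> says about \<open>b\<close> and \<open>e\<close>, pointwise, and the recoloring in these terms.\<close>
  define lowered where "lowered \<kappa> b e \<longleftrightarrow> b \<in> M \<and> e \<in> V - M \<and> {u \<in> V. (u, e) \<in> r} = {b} \<and>
      (\<forall>v\<in>V. \<kappa> v = 0 \<longleftrightarrow> v = b) \<and>
      (\<forall>v\<in>V. \<kappa> v = 1 \<longleftrightarrow> v = e \<or> v \<in> M \<and> v \<noteq> b) \<and>
      (\<forall>v\<in>V. h \<kappa> v = (if v \<in> M then 0 else if v = e then 1 else \<kappa> v)) \<and>
      (\<forall>v\<in>V. v \<in> M \<or> v = e \<or> \<kappa> v \<ge> 2)" for \<kappa> b e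
  have loweredD: "b \<in> M" "e \<in> V - M" "{u \<in> V. (u, e) \<in> r} = {b}"
      "\<And>v. v \<in> V \<Longrightarrow> \<kappa> v = 0 \<longleftrightarrow> v = b"
      "\<And>v. v \<in> V \<Longrightarrow> \<kappa> v = 1 \<longleftrightarrow> v = e \<or> v \<in> M \<and> v \<noteq> b"
      "\<And>v. v \<in> V \<Longrightarrow> h \<kappa> v = (if v \<in> M then 0 else if v = e then 1 else \<kappa> v)"
      "\<And>v. v \<in> V \<Longrightarrow> v \<in> M \<or> v = e \<or> \<kappa> v \<ge> 2"
    if "lowered \<kappa> b e" for \<kappa> b e
    using that unfolding lowered_def by metis+
  have shape: "\<exists>b e. lowered \<kappa> b e" if C: "\<kappa> \<in> ?C" for \<kappa>
  proof -
    note \<kappa> = colorings_of_typeD[OF C]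
    have "count (image_mset ?s m) 0 = 1" "count (image_mset ?s m) 1 = card M"
      using count_image_mset_bij[of ?s m 0] count_image_mset_bij[of ?s m 1] m0 m1 by simp_all
    then have z: "card {v \<in> V. \<kappa> v = 0} = 1" and o: "card {v \<in> V. \<kappa> v = 1} = card (minimal_elements r V)"
      by (simp_all only: count_type_on[OF V(1), of \<kappa>, symmetric] \<kappa>(2) M_def)
    obtain b e where be: "b \<in> M" "e \<in> V - M" "{v \<in> V. \<kappa> v = 0} = {b}"
      "{v \<in> V. \<kappa> v = 1} = insert e (M - {b})" "{u \<in> V. (u, e) \<in> r} = {b}"
      by (rule almost_minimal_class[OF V \<kappa>(1) z o, folded M_def])
    have k0: "\<kappa> v = 0 \<longleftrightarrow> v = b" if "v \<in> V" for v
      using be(3) that by (auto simp: set_eq_iff)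
    have k1: "\<kappa> v = 1 \<longleftrightarrow> v = e \<or> v \<in> M \<and> v \<noteq> b" if "v \<in> V" for v
    proof -
      have "v \<in> {v \<in> V. \<kappa> v = 1} \<longleftrightarrow> v \<in> insert e (M - {b})"
        by (simp only: be(4))
      then show ?thesis using that by simp
    qed
    have hv: "h \<kappa> v = (if v \<in> M then 0 else if v = e then 1 else \<kappa> v)" if "v \<in> V" for v
    proof -
      have "v \<in> M \<or> (\<kappa> v \<le> 1 \<longleftrightarrow> v = e)"
        using k0[OF that] k1[OF that] be(1) by (cases "\<kappa> v = 0"; cases "\<kappa> v = 1") auto
      then show ?thesis using that by (auto simp: h_def)
    qed
    have big: "v \<in> M \<or> v = e \<or> \<kappa> v \<ge> 2" if "v \<in> V" for v
    proof (cases "\<kappa> v = 0 \<or> \<kappa> v = 1")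
      case True
      then show ?thesis using k0[OF that] k1[OF that] be(1) by auto
    qed simp
    have "lowered \<kappa> b e"
      unfolding lowered_def by (intro conjI ballI be(1,2,5) k0 k1 hv big)
    then show ?thesis by blast
  qed
  have sub: "h ` ?C \<subseteq> colorings_of_type r V m"
  proof (rule image_subsetI)
    fix \<kappa> assume C: "\<kappa> \<in> ?C"
    note inc = colorings_of_typeD(1)[OF C] and type = colorings_of_typeD(2)[OF C]
    obtain b e where l: "lowered \<kappa> b e"
      using shape[OF C] by blast
    note b = loweredD(1)[OF l] and e = loweredD(2)[OF l] and lower = loweredD(3)[OF l]
      and k0 = loweredD(4)[OF l] and k1 = loweredD(5)[OF l] and hv = loweredD(6)[OF l]
      and big = loweredD(7)[OF l]
    have "h \<kappa> u < h \<kappa> v" if uv: "u \<in> V" "v \<in> V" "(u, v) \<in> r" for u v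
    proof -
      have vM: "v \<notin> M"
        using uv by (auto simp: M_def minimal_elements_def)
      show ?thesis
      proof (cases "v = e")
        case True
        then have "u \<in> {u \<in> V. (u, e) \<in> r}"
          using uv by simp
        then have "u \<in> M"
          using b unfolding lower by simp
        then show ?thesis
          unfolding hv[OF uv(1)] hv[OF uv(2)] using True vM by simp
      next
        case False
        moreover have "\<kappa> u < \<kappa> v"
          using inc uv by (rule increasing_coloringsD)
        ultimately show ?thesis
          unfolding hv[OF uv(1)] hv[OF uv(2)] using vM big[OF uv(2)] by auto
      qed
    qed
    then have "h \<kappa> \<in> increasing_colorings r V"
      unfolding h_def by (intro restrict_increasing) simp
    moreover have "type_on V (h \<kappa>) = m"
    proof (rule multiset_eqI)
      fix i :: nat
      consider "i = 0" | "i = 1" | "i \<ge> 2"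
        by linarith
      then show "count (type_on V (h \<kappa>)) i = count m i"
      proof cases
        case 1
        have "h \<kappa> v = 0 \<longleftrightarrow> v \<in> M" if "v \<in> V" for v
          using big[OF that] by (auto simp: hv[OF that])
        then have "{v \<in> V. h \<kappa> v = 0} = M"
          using MV by auto
        then show ?thesis
          using 1 m0 count_type_on[OF V(1), of "h \<kappa>" 0] by simp
      next
        case 2
        have "h \<kappa> v = 1 \<longleftrightarrow> v = e" if "v \<in> V" for v
          using big[OF that] e by (auto simp: hv[OF that])
        then have "{v \<in> V. h \<kappa> v = 1} = {e}"
          using e by auto
        then show ?thesis
          using 2 m1 count_type_on[OF V(1), of "h \<kappa>" 1] by simp
      next
        case 3
        have "h \<kappa> v = i \<longleftrightarrow> \<kappa> v = i" if "v \<in> V" for v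
          using 3 k0[OF that] k1[OF that] by (auto simp: hv[OF that])
        then have "{v \<in> V. h \<kappa> v = i} = {v \<in> V. \<kappa> v = i}"
          by auto
        then have "count (type_on V (h \<kappa>)) i = count (type_on V \<kappa>) i"
          by (simp only: count_type_on[OF V(1)])
        also have "\<dots> = count m i"
          using 3 type count_image_mset_bij[of ?s m i] by simp
        finally show ?thesis .
      qed
    qed
    ultimately show "h \<kappa> \<in> colorings_of_type r V m"
      by (simp add: colorings_of_type_def)
  qed
  have inj: "inj_on h ?C"
  proof (rule inj_onI)
    fix \<kappa> \<kappa>' assume C: "\<kappa> \<in> ?C" and C': "\<kappa>' \<in> ?C" and eq: "h \<kappa> = h \<kappa>'"
    obtain b e where l: "lowered \<kappa> b e"
      using shape[OF C] by blast
    note b = loweredD(1)[OF l] and e = loweredD(2)[OF l] and lower = loweredD(3)[OF l]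
      and k0 = loweredD(4)[OF l] and k1 = loweredD(5)[OF l] and hv = loweredD(6)[OF l]
      and big = loweredD(7)[OF l]
    obtain b' e' where l': "lowered \<kappa>' b' e'"
      using shape[OF C'] by blast
    note b' = loweredD(1)[OF l'] and e' = loweredD(2)[OF l'] and lower' = loweredD(3)[OF l']
      and k0' = loweredD(4)[OF l'] and k1' = loweredD(5)[OF l'] and hv' = loweredD(6)[OF l']
      and big' = loweredD(7)[OF l']
    have eV: "e \<in> V" "e \<notin> M"
      using e by auto
    have "h \<kappa>' e = 1"
      unfolding eq[symmetric] hv[OF eV(1)] using eV by simp
    then have ee: "e' = e"
      unfolding hv'[OF eV(1)] using eV big'[OF eV(1)] by (auto split: if_splits)
    then have bb: "b' = b"
      using lower lower' by simp
    show "\<kappa> = \<kappa>'"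
    proof (rule ext)
      fix x
      show "\<kappa> x = \<kappa>' x"
      proof (cases "x \<in> V")
        case False
        then show ?thesis
          using C C' by (simp add: colorings_of_type_def increasing_colorings_def PiE_iff extensional_def)
      next
        case True
        have "\<kappa> x = 0 \<longleftrightarrow> \<kappa>' x = 0" "\<kappa> x = 1 \<longleftrightarrow> \<kappa>' x = 1"
          by (simp_all only: k0[OF True] k0'[OF True] k1[OF True] k1'[OF True] ee bb)
        moreover have "\<kappa> x = 0 \<or> \<kappa> x = 1" if "x \<in> M \<or> x = e"
          using that k0[OF True] k1[OF True] by blast
        moreover have "\<kappa> x = \<kappa>' x" if "\<not> (x \<in> M \<or> x = e)"
          using that hv[OF True] hv'[OF True] unfolding eq ee by simp
        ultimately show ?thesis
          by (cases "x \<in> M \<or> x = e") auto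
      qed
    qed
  qed
  have "card (h ` ?C) = card (colorings_of_type r V m)"
    using card_image[OF inj] symmetric_posetD[OF V(4) bij_transpose] by simp
  then have "h ` ?C = colorings_of_type r V m"
    by (intro card_subset_eq[OF finite_colorings_of_type[OF V(1)] sub])
  moreover have "\<kappa>0 \<in> colorings_of_type r V m"
    unfolding m_def by (rule colorings_of_typeI[OF \<kappa>0])
  ultimately obtain \<kappa> where C: "\<kappa> \<in> ?C" and k: "\<kappa>0 = h \<kappa>"
    by blast
  obtain b e where l: "lowered \<kappa> b e"
    using shape[OF C] by blast
  note lower = loweredD(3)[OF l] and hv = loweredD(6)[OF l] and big = loweredD(7)[OF l]
  have "h \<kappa> c = 1"
    using k[symmetric] cV by (simp add: \<kappa>0_def)
  moreover have "c \<in> V" "c \<notin> M"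
    using cV by auto
  ultimately have "c = e"
    using hv[of c] big[of c] by presburger
  then show ?thesis
    using lower by blast
qed

text \<open>
  Two elements sitting above the same single \<open>b\<close> would form with the remaining minimal elements an
  antichain that is too large.
\<close>

lemma second_level_distinct_lower:
  assumes V: "finite V" "trans r" "irrefl r" "symmetric_poset r V"
  defines "M \<equiv> minimal_elements r V"
  assumes c: "c \<in> minimal_elements r (V - M)" "{u \<in> V. (u, c) \<in> r} = {b}"
    and d: "d \<in> minimal_elements r (V - M)" "{u \<in> V. (u, d) \<in> r} = {b}"
  shows "c = d"
proof (rule ccontr)
  assume "c \<noteq> d"
  have MV: "M \<subseteq> V" and finM: "finite M" and cd: "c \<in> V - M" "d \<in> V - M"
    using V(1) c(1) d(1) by (auto simp: M_def minimal_elements_def)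
  have bV: "b \<in> V" "(b, c) \<in> r"
    using c(2) by auto
  have bM: "b \<in> M"
    using bV c(1) by (auto simp: minimal_elements_def[of _ "V - M"])
  have "antichain r ({c, d} \<union> (M - {b}))"
    unfolding antichain_def
  proof (intro ballI notI)
    fix u v assume u: "u \<in> {c, d} \<union> (M - {b})" and v: "v \<in> {c, d} \<union> (M - {b})" and uv: "(u, v) \<in> r"
    have uV: "u \<in> V" "v \<in> V"
      using u v MV cd by auto
    then have "v \<notin> M"
      using uv by (auto simp: M_def minimal_elements_def)
    then have "v = c \<or> v = d"
      using v by blast
    then have "u = b"
      using c(2) d(2) uV uv by blast
    then show False
      using u bM cd by blast
  qed
  then have "card ({c, d} \<union> (M - {b})) \<le> card M"
    unfolding M_def using MV cd by (intro symmetric_poset_width[OF V]) (auto simp: M_def)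
  moreover have "card ({c, d} \<union> (M - {b})) = 2 + (card M - 1)"
    using finM bM cd \<open>c \<noteq> d\<close> by (subst card_Un_disjoint) auto
  moreover have "card M > 0"
    using bM finM card_gt_0_iff by blast
  ultimately show False
    by linarith
qed

section \<open>Symmetric posets are disjoint unions of chains\<close>

text \<open>
  The map \<open>root\<close> describes a cover of the poset by chains, one for each minimal element. The relations
  within the chains form a poset \<open>r'\<close> that is symmetric as well and has at least the colorings of \<open>r\<close>.
  Relations of \<open>r\<close> between different chains can only start in minimal elements, so they hold in any
  coloring of \<open>r'\<close> in which exactly the minimal elements have color 0. For the type where color 0 is used
  \<open>|M|\<close> times the numbers of colorings thus agree, and symmetry transports this to the types where
  another color is used \<open>|M|\<close> times. There a relation between different chains would be violated by
  some coloring of \<open>r'\<close>.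
\<close>

lemma chain_cover_exhausts_relations:
  fixes root :: "'a \<Rightarrow> 'a"
  assumes V: "finite V" "trans r" "irrefl r" "symmetric_poset r V"
  defines "M \<equiv> minimal_elements r V"
  assumes root_M: "\<And>v. v \<in> V \<Longrightarrow> root v \<in> M"
    and root_id: "\<And>v. v \<in> M \<Longrightarrow> root v = v"
    and root_below: "\<And>v. v \<in> V - M \<Longrightarrow> (root v, v) \<in> r"
    and same_root: "\<And>u v. u \<in> V \<Longrightarrow> v \<in> V \<Longrightarrow> root u = root v \<Longrightarrow> comparable r u v"
    and upper: "\<And>u v. u \<in> V - M \<Longrightarrow> v \<in> V - M \<Longrightarrow> (u, v) \<in> r \<Longrightarrow> root u = root v"
    and xy: "x \<in> V" "y \<in> V" "(y, x) \<in> r"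
  shows "root y = root x"
proof (rule ccontr)
  assume neq: "root y \<noteq> root x"
  have MV: "M \<subseteq> V"
    by (auto simp: M_def minimal_elements_def)
  then have finM: "finite M"
    using V(1) by (rule finite_subset)
  have xM: "x \<notin> M"
    using xy by (auto simp: M_def minimal_elements_def)
  have yM: "y \<in> M"
    using upper[of y x] neq xy xM by blast
  define r' where "r' = {(u, v) \<in> r. u \<in> V \<and> v \<in> V \<and> root u = root v}"
  have r'I: "(u, v) \<in> r'" if "(u, v) \<in> r" "u \<in> V" "v \<in> V" "root u = root v" for u v
    using that by (simp add: r'_def)
  have r'D: "(u, v) \<in> r" "u \<in> V" "v \<in> V" "root u = root v" if "(u, v) \<in> r'" for u v
    using that by (simp_all add: r'_def)
  have trans': "trans r'"
  proof (rule transI)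
    fix u v w assume uv: "(u, v) \<in> r'" and vw: "(v, w) \<in> r'"
    show "(u, w) \<in> r'"
      using r'D[OF uv] r'D[OF vw] transD[OF V(2) r'D(1)[OF uv] r'D(1)[OF vw]] by (intro r'I) simp_all
  qed
  have irrefl': "irrefl r'"
    using V(3) by (auto simp: irrefl_def r'_def)
  have comparable': "comparable r' u v \<longleftrightarrow> root u = root v" if "u \<in> V" "v \<in> V" for u v
  proof
    show "root u = root v" if "comparable r' u v"
      using that by (auto simp: comparable_def dest: r'D(4))
    show "comparable r' u v" if "root u = root v"
      using same_root[OF \<open>u \<in> V\<close> \<open>v \<in> V\<close> that] that \<open>u \<in> V\<close> \<open>v \<in> V\<close>
      by (auto simp: comparable_def r'_def)
  qed
  have "union_of_chains r' V"
    unfolding union_of_chains_def by (simp add: comparable')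
  then have sym': "symmetric_poset r' V"
    by (rule union_of_chains_symmetric[OF V(1)])
  \<comment> \<open>One element of each chain, with both \<open>x\<close> and \<open>y\<close> among them.\<close>
  define A where "A = insert x (M - {root x})"
  have AV: "A \<subseteq> V"
    using MV xy by (auto simp: A_def)
  have "antichain r' A"
    unfolding antichain_def
  proof (intro ballI notI)
    fix u v assume u: "u \<in> A" and v: "v \<in> A" and uv: "(u, v) \<in> r'"
    have "u = v"
      using u v r'D(4)[OF uv] root_id by (auto simp: A_def)
    then show False
      using uv irrefl' by (auto simp: irrefl_def)
  qed
  then obtain \<kappa> c where \<kappa>: "\<kappa> \<in> increasing_colorings r' V" and \<kappa>A: "{v \<in> V. \<kappa> v = c} = A"
    using antichain_coloring[OF V(1) trans' irrefl' AV] by blast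
  define m where "m = type_on V \<kappa>"
  define m' where "m' = image_mset (transpose 0 c) m"
  have "card A = card M"
    using xM root_M[OF xy(1)] finM by (simp add: A_def card.insert_remove card_Diff_singleton)
       (metis Suc_pred card_gt_0_iff empty_iff)
  then have "count m c = card M"
    using \<kappa>A by (simp add: m_def count_type_on[OF V(1)])
  then have m'0: "count m' 0 = card M"
    using count_image_mset_bij[of "transpose 0 c" m c] by (simp add: m'_def)
  have "\<kappa> \<in> colorings_of_type r' V m"
    unfolding m_def by (rule colorings_of_typeI[OF \<kappa>])
  moreover have "\<kappa> \<notin> colorings_of_type r V m"
  proof
    assume C: "\<kappa> \<in> colorings_of_type r V m"
    have "\<kappa> y < \<kappa> x"
      by (rule increasing_coloringsD[OF colorings_of_typeD(1)[OF C] xy(2,1,3)])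
    moreover have "x \<in> A" "y \<in> A"
      using yM neq root_id by (auto simp: A_def)
    ultimately show False
      using \<kappa>A by auto
  qed
  moreover have "colorings_of_type r V m \<subseteq> colorings_of_type r' V m"
    by (auto simp: colorings_of_type_def increasing_colorings_def dest: r'D(1))
  ultimately have "card (colorings_of_type r V m) < card (colorings_of_type r' V m)"
    by (intro psubset_card_mono finite_colorings_of_type[OF V(1)]) blast
  also have "\<dots> = card (colorings_of_type r' V m')"
    unfolding m'_def by (rule symmetric_posetD[OF sym' bij_transpose, symmetric])
  also have "\<dots> \<le> card (colorings_of_type r V m')"
  proof (intro card_mono finite_colorings_of_type[OF V(1)] subsetI)
    fix \<kappa>1 assume C: "\<kappa>1 \<in> colorings_of_type r' V m'"
    have inc: "\<kappa>1 \<in> increasing_colorings r' V"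
      by (rule colorings_of_typeD(1)[OF C])
    have "minimal_elements r' V = M"
    proof
      show "minimal_elements r' V \<subseteq> M"
      proof
        fix v assume v: "v \<in> minimal_elements r' V"
        then have vV: "v \<in> V"
          by (simp add: minimal_elements_def)
        show "v \<in> M"
        proof (rule ccontr)
          assume "v \<notin> M"
          then have "(root v, v) \<in> r'"
            using vV root_M[OF vV] root_below[of v] root_id MV by (intro r'I) auto
          then show False
            using v r'D(2) by (auto simp: minimal_elements_def)
        qed
      qed
      show "M \<subseteq> minimal_elements r' V"
        using r'D(1) by (auto simp: minimal_elements_def M_def)
    qed
    then have zero: "{v \<in> V. \<kappa>1 v = 0} = M"
      using minimal_elements_color_class[OF V(1) inc] colorings_of_typeD(2)[OF C] m'0 by simp
    have "\<kappa>1 u < \<kappa>1 v" if uv: "u \<in> V" "v \<in> V" "(u, v) \<in> r" for u v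
    proof (cases "root u = root v")
      case True
      then show ?thesis
        using increasing_coloringsD[OF inc uv(1,2)] r'I uv by simp
    next
      case False
      have "v \<notin> M"
        using uv by (auto simp: M_def minimal_elements_def)
      moreover have "u \<in> M"
        using upper[of u v] False uv \<open>v \<notin> M\<close> by blast
      ultimately have "\<kappa>1 u = 0" "\<kappa>1 v \<noteq> 0"
        using zero uv by auto
      then show ?thesis by simp
    qed
    then have "\<kappa>1 \<in> increasing_colorings r V"
      using inc by (simp add: increasing_colorings_def)
    then show "\<kappa>1 \<in> colorings_of_type r V m'"
      using colorings_of_typeD(2)[OF C] by (simp add: colorings_of_type_def)
  qed
  also have "\<dots> = card (colorings_of_type r V m)"
    unfolding m'_def by (rule symmetric_posetD[OF V(4) bij_transpose])
  finally show False
    by simp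
qed

text \<open>
  Above the minimal elements the poset is a union of chains by induction. Each such chain is assigned to
  the unique minimal element below its bottom, which yields a chain cover, and this cover accounts for
  all relations.
\<close>

theorem symmetric_poset_union_of_chains:
  assumes r: "trans r" "irrefl r" and "finite V" "symmetric_poset r V"
  shows "union_of_chains r V"
  using assms(3,4)
proof (induction "card V" arbitrary: V rule: less_induct)
  case (less V)
  note V = less.prems(1) r less.prems(2)
  define M where "M = minimal_elements r V"
  define Q where "Q = V - M"
  define L where "L = minimal_elements r Q"
  show ?case
  proof (cases "V = {}")
    case True
    then show ?thesis by (simp add: union_of_chains_def)
  next
    case False
    have MV: "M \<subseteq> V" and QV: "Q \<subseteq> V"
      by (auto simp: M_def Q_def minimal_elements_def)
    have finQ: "finite Q"
      using V(1) by (simp add: Q_def)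
    have "M \<noteq> {}"
      using False minimal_below[OF V(1-3)] by (auto simp: M_def)
    then have "card Q < card V"
      using MV V(1) by (auto simp: Q_def intro!: psubset_card_mono)
    moreover have "symmetric_poset r Q"
      unfolding Q_def M_def by (rule symmetric_poset_without_minimal[OF V(1,4)])
    ultimately have chains: "union_of_chains r Q"
      using less.hyps finQ by blast
    have "\<forall>c\<in>L. \<exists>b. {u \<in> V. (u, c) \<in> r} = {b}"
      using second_level_unique_lower[OF V] by (simp add: L_def Q_def M_def)
    then obtain low where low: "\<And>c. c \<in> L \<Longrightarrow> {u \<in> V. (u, c) \<in> r} = {low c}"
      by metis
    have "\<forall>v\<in>Q. \<exists>c\<in>L. c = v \<or> (c, v) \<in> r"
      using minimal_below[OF finQ r] by (simp add: L_def)
    then obtain bot where bot: "\<And>v. v \<in> Q \<Longrightarrow> bot v \<in> L" "\<And>v. v \<in> Q \<Longrightarrow> bot v = v \<or> (bot v, v) \<in> r"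
      by metis
    have LQ: "L \<subseteq> Q"
      by (auto simp: L_def minimal_elements_def)
    have lowV: "low c \<in> V" "(low c, c) \<in> r" if "c \<in> L" for c
      using low[OF that] by auto
    have lowM: "low c \<in> M" if "c \<in> L" for c
    proof (rule ccontr)
      assume "low c \<notin> M"
      then have "low c \<in> Q"
        using lowV[OF that] by (simp add: Q_def)
      then show False
        using lowV(2)[OF that] that by (auto simp: L_def minimal_elements_def)
    qed
    define root where "root v = (if v \<in> M then v else low (bot v))" for v
    have Q: "v \<in> Q \<longleftrightarrow> v \<in> V \<and> v \<notin> M" for v
      by (simp add: Q_def)
    have below: "(low (bot v), v) \<in> r" if "v \<in> Q" for v
      using bot[OF that] lowV(2)[of "bot v"] transD[OF r(1), of "low (bot v)" "bot v" v] by metis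
    have low_inj: "c = d" if cd: "c \<in> L" "d \<in> L" and eq: "low c = low d" for c d
    proof (rule second_level_distinct_lower[OF V])
      show "c \<in> minimal_elements r (V - minimal_elements r V)"
        "d \<in> minimal_elements r (V - minimal_elements r V)"
        using cd by (simp_all only: L_def Q_def M_def)
      show "{u \<in> V. (u, c) \<in> r} = {low c}" "{u \<in> V. (u, d) \<in> r} = {low c}"
        using low[OF cd(1)] low[OF cd(2)] by (simp_all only: eq)
    qed
    have bot_comparable: "comparable r (bot v) v" if "v \<in> Q" for v
      using bot(2)[OF that] by (auto simp: comparable_def)
    have same_bot: "bot u = bot v" if uv: "u \<in> Q" "v \<in> Q" "comparable r u v" for u v
    proof -
      have bQ: "bot u \<in> Q" "bot v \<in> Q"
        using bot(1) LQ uv by blast+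
      have "comparable r (bot u) v"
        by (rule union_of_chainsD[OF chains bQ(1) uv(1,2) bot_comparable[OF uv(1)] uv(3)])
      then have "comparable r (bot u) (bot v)"
        by (rule union_of_chainsD[OF chains bQ(1) uv(2) bQ(2) _ comparable_sym[OF bot_comparable[OF uv(2)]]])
      then show ?thesis
        using bot(1)[OF uv(1)] bot(1)[OF uv(2)] bQ by (auto simp: comparable_def L_def minimal_elements_def)
    qed
    have same_root: "comparable r u v" if uv: "u \<in> V" "v \<in> V" "root u = root v" for u v
    proof (cases "u \<in> M"; cases "v \<in> M")
      assume "u \<in> M" "v \<in> M"
      then show ?thesis using uv by (simp add: root_def)
    next
      assume "u \<in> M" "v \<notin> M"
      then show ?thesis using uv below[of v] by (simp add: root_def comparable_def Q)
    next
      assume "u \<notin> M" "v \<in> M"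
      then show ?thesis using uv below[of u] by (simp add: root_def comparable_def Q)
    next
      assume "u \<notin> M" "v \<notin> M"
      then have Q': "u \<in> Q" "v \<in> Q"
        using uv by (simp_all add: Q)
      then have bb: "bot u = bot v"
        using uv(3) low_inj[OF bot(1)[of u] bot(1)[of v]] by (simp add: root_def Q)
      have "bot u \<in> Q"
        using bot(1)[OF Q'(1)] LQ by blast
      then show ?thesis
        using union_of_chainsD[OF chains Q'(1) _ Q'(2)] comparable_sym[OF bot_comparable[OF Q'(1)]]
          bot_comparable[OF Q'(2)] bb by metis
    qed
    have relations: "root y = root x" if xy: "x \<in> V" "y \<in> V" "(y, x) \<in> r" for x y
    proof (rule chain_cover_exhausts_relations[OF V, folded M_def, where root = root])
      show "root v \<in> M" if "v \<in> V" for v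
        using that lowM bot(1) by (auto simp: root_def Q)
      show "root v = v" if "v \<in> M" for v
        using that by (simp add: root_def)
      show "(root v, v) \<in> r" if "v \<in> V - M" for v
        using that below by (simp add: root_def Q)
      show "root u = root v" if "u \<in> V - M" "v \<in> V - M" "(u, v) \<in> r" for u v
        using that same_bot[of u v] by (simp add: root_def Q comparable_def)
    qed (use same_root xy in blast)+
    have "root u = root v" if "u \<in> V" "v \<in> V" "comparable r u v" for u v
      using that relations[of u v] relations[of v u] by (auto simp: comparable_def)
    then show ?thesis
      unfolding union_of_chains_def using same_root by metis
  qed
qed

section \<open>Directed paths\<close>

lemma ascents_conv_card: "ascents w = card {i. Suc i < length w \<and> w ! i < w ! Suc i}"
proof -
  have "ascents w = card {i. i < length w - 1 \<and> w ! i < tl w ! i}"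
    by (simp add: ascents_def length_filter_conv_card cong: conj_cong)
  also have "{i. i < length w - 1 \<and> w ! i < tl w ! i} = {i. Suc i < length w \<and> w ! i < w ! Suc i}"
    by (auto simp: nth_tl)
  finally show ?thesis .
qed

text \<open>
  A coloring is the word of its colors along the path. Words may contain the letter 0 and have any
  length, which accounts for the two conditions.
\<close>

lemma chromatic_quasisymmetric_directed_path:
  assumes vs: "distinct vs" "pverts G = set vs"
    and arcs: "parcs G = {(vs ! i, vs ! Suc i) | i. Suc i < length vs}"
  shows "chromatic_quasisymmetric G m
    = (if 0 \<notin># m \<and> size m = length vs then path_series m else 0)"
proof -
  let ?K = "{\<kappa>. \<kappa> \<in> proper_colorings G \<and> coloring_monomial G \<kappa> = m}"
  have monomial: "coloring_monomial G \<kappa> = mset (map \<kappa> vs)" for \<kappa>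
    using vs by (simp add: coloring_monomial_def mset_set_set)
  show ?thesis
  proof (cases "0 \<notin># m \<and> size m = length vs")
    case False
    have "0 \<notin># m \<and> size m = length vs" if "\<kappa> \<in> ?K" for \<kappa>
      using that vs(2) by (force simp: monomial proper_colorings_def)
    then have "?K = {}"
      using False by blast
    then show ?thesis
      using False by (simp only: chromatic_quasisymmetric_def sum.empty if_False)
  next
    case True
    have arcs_ball: "(\<forall>(u, v) \<in> parcs G. P u v) \<longleftrightarrow> (\<forall>i. Suc i < length vs \<longrightarrow> P (vs ! i) (vs ! Suc i))" for P
      unfolding arcs by blast
    have proper: "(\<forall>(u, v) \<in> parcs G. \<kappa> u \<noteq> \<kappa> v) \<longleftrightarrow> distinct_adj (map \<kappa> vs)" for \<kappa> :: "'a \<Rightarrow> nat"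
      by (simp add: arcs_ball distinct_adj_conv_nth)
    have asc: "asc G \<kappa> = ascents (map \<kappa> vs)" for \<kappa>
    proof -
      let ?I = "{i. Suc i < length vs \<and> \<kappa> (vs ! i) < \<kappa> (vs ! Suc i)}"
      have "{(u, v) \<in> parcs G. \<kappa> u < \<kappa> v} = (\<lambda>i. (vs ! i, vs ! Suc i)) ` ?I"
        unfolding arcs by auto
      moreover have "inj_on (\<lambda>i. (vs ! i, vs ! Suc i)) ?I"
        using vs(1) by (auto simp: inj_on_def nth_eq_iff_index_eq)
      moreover have "?I = {i. Suc i < length (map \<kappa> vs) \<and> map \<kappa> vs ! i < map \<kappa> vs ! Suc i}"
        by auto
      ultimately show ?thesis
        by (simp only: asc_def ascents_conv_card card_image)
    qed
    have "bij_betw (\<lambda>\<kappa>. map \<kappa> vs) ?K {w. distinct_adj w \<and> mset w = m}"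
    proof (rule bij_betw_imageI)
      show "inj_on (\<lambda>\<kappa>. map \<kappa> vs) ?K"
      proof (rule inj_onI)
        fix \<kappa> \<kappa>' assume K: "\<kappa> \<in> ?K" "\<kappa>' \<in> ?K" and eq: "map \<kappa> vs = map \<kappa>' vs"
        show "\<kappa> = \<kappa>'"
        proof (rule extensionalityI)
          show "\<kappa> \<in> extensional (set vs)" "\<kappa>' \<in> extensional (set vs)"
            using K vs(2) by (simp_all add: proper_colorings_def PiE_iff)
        qed (use eq in simp)
      qed
      show "(\<lambda>\<kappa>. map \<kappa> vs) ` ?K = {w. distinct_adj w \<and> mset w = m}"
      proof
        show "(\<lambda>\<kappa>. map \<kappa> vs) ` ?K \<subseteq> {w. distinct_adj w \<and> mset w = m}"
          by (auto simp: proper_colorings_def proper monomial)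
        show "{w. distinct_adj w \<and> mset w = m} \<subseteq> (\<lambda>\<kappa>. map \<kappa> vs) ` ?K"
        proof
          fix w assume "w \<in> {w. distinct_adj w \<and> mset w = m}"
          then have w: "distinct_adj w" "mset w = m"
            by auto
          then have len: "length w = length vs"
            using True by (metis size_mset)
          define f where "f = the_inv_into {..<length vs} ((!) vs)"
          define \<kappa> where "\<kappa> = restrict (\<lambda>v. w ! f v) (set vs)"
          have "f (vs ! i) = i" if "i < length vs" for i
            unfolding f_def using vs(1) that by (intro the_inv_into_f_f) (auto simp: inj_on_nth)
          then have map: "map \<kappa> vs = w"
            by (intro nth_equalityI) (simp_all add: \<kappa>_def len)
          have "\<kappa> v \<ge> 1" if "v \<in> set vs" for v
          proof -
            have "\<kappa> v \<in># m"
              using that map w(2) by (metis image_eqI set_map set_mset_mset)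
            then have "\<kappa> v \<noteq> 0"
              using True by metis
            then show ?thesis by simp
          qed
          then have "\<kappa> \<in> pverts G \<rightarrow>\<^sub>E {1..}"
            by (simp add: vs(2) PiE_iff) (simp add: \<kappa>_def)
          then have "\<kappa> \<in> ?K"
            using w by (simp only: proper_colorings_def proper monomial map mem_Collect_eq simp_thms)
          then show "w \<in> (\<lambda>\<kappa>. map \<kappa> vs) ` ?K"
            by (rule image_eqI[where x = \<kappa>, rotated]) (simp only: map)
        qed
      qed
    qed
    then have "(\<Sum>\<kappa>\<in>?K. monom 1 (ascents (map \<kappa> vs))) = path_series m"
      unfolding path_series_def by (rule sum.reindex_bij_betw)
    then show ?thesis
      using True by (simp add: chromatic_quasisymmetric_def asc)
  qed
qed

lemma directed_path_symmetric:
  assumes "directed_path G"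
  shows "symmetric_series (chromatic_quasisymmetric G)"
proof -
  obtain vs where vs: "distinct vs" "pverts G = set vs"
      "parcs G = {(vs ! i, vs ! Suc i) | i. Suc i < length vs}"
    using assms by (auto simp: directed_path_def)
  show ?thesis
    unfolding symmetric_series_def
  proof (intro allI impI)
    fix \<sigma> :: "nat \<Rightarrow> nat" and m assume \<sigma>: "\<sigma> permutes {1..}"
    have inj: "inj \<sigma>"
      using \<sigma> by (rule permutes_inj)
    have "\<sigma> 0 = 0"
      using permutes_not_in[OF \<sigma>, of 0] by simp
    then have "0 \<in># image_mset \<sigma> m \<longleftrightarrow> 0 \<in># m"
      using inj by (auto simp: inj_eq image_iff) (metis injD)
    moreover have "path_series (image_mset \<sigma> m) = path_series m"
      using inj by (intro path_series_symmetric) (rule inj_on_subset, auto)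
    ultimately show "chromatic_quasisymmetric G (image_mset \<sigma> m) = chromatic_quasisymmetric G m"
      by (simp only: chromatic_quasisymmetric_directed_path[OF vs] size_image_mset)
  qed
qed

section \<open>Directed trees\<close>

text \<open>
  Sorting by the number of smaller elements lists a finite strict linear order.
\<close>

lemma linear_order_list:
  assumes V: "finite V" "trans r" "irrefl r"
    and total: "\<And>u v. u \<in> V \<Longrightarrow> v \<in> V \<Longrightarrow> comparable r u v"
  obtains vs where "distinct vs" "set vs = V"
    "\<forall>i<length vs. \<forall>j<length vs. (vs ! i, vs ! j) \<in> r \<longleftrightarrow> i < j"
proof -
  obtain us where us: "set us = V" "distinct us"
    using finite_distinct_list[OF V(1)] by blast
  define vs where "vs = sort_key (number_below r V) us"
  have vs: "distinct vs" "set vs = V"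
    using us by (simp_all add: vs_def)
  have less: "(vs ! i, vs ! j) \<in> r" if ij: "i < j" "j < length vs" for i j
  proof -
    have in_V: "vs ! i \<in> V" "vs ! j \<in> V"
      using ij vs(2) by auto
    have "vs ! i \<noteq> vs ! j"
      using ij vs(1) by (simp add: nth_eq_iff_index_eq)
    moreover have "number_below r V (vs ! i) \<le> number_below r V (vs ! j)"
      using sorted_nth_mono[of "map (number_below r V) vs" i j] ij by (simp add: vs_def)
    then have "(vs ! j, vs ! i) \<notin> r"
      using number_below_less[OF V in_V(2), of "vs ! i"] by auto
    ultimately show ?thesis
      using total[OF in_V] by (simp add: comparable_def)
  qed
  have "(vs ! i, vs ! j) \<in> r \<longleftrightarrow> i < j" if "i < length vs" "j < length vs" for i j
  proof
    assume ij: "(vs ! i, vs ! j) \<in> r"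
    show "i < j"
    proof (rule ccontr)
      assume "\<not> i < j"
      then have "vs ! j = vs ! i \<or> (vs ! j, vs ! i) \<in> r"
        using less[of j i] that by (cases "i = j") auto
      then have "(vs ! i, vs ! i) \<in> r"
        using ij transD[OF V(2) ij] by metis
      then show False
        using V(3) by (simp add: irrefl_def)
    qed
  qed (use less that in blast)
  then show ?thesis
    using that vs by blast
qed

abbreviation (in directed_tree) "underlying \<equiv> with_proj (mk_symmetric (with_proj G))"

text \<open>
  The additional facts about the path keep a further vertex off it when it is closed up to a cycle.
\<close>

lemma (in directed_tree) reachable_path:
  assumes "(u, v) \<in> (parcs G)\<^sup>*" "u \<in> pverts G"
  obtains p where "pre_digraph.awalk underlying u p v" "distinct (pawalk_verts u p)"
    "\<And>w. w \<in> set (pawalk_verts u p) \<Longrightarrow> (u, w) \<in> (parcs G)\<^sup>*"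
    "set p \<subseteq> parcs G"
proof -
  have reach: "u \<rightarrow>\<^sup>*\<^bsub>with_proj G\<^esub> v"
    using assms by (metis rtrancl_eq_or_trancl reachable1_reachable with_proj_simps(1,3) reachable_refl)
  then obtain p where p: "apath u p v"
    unfolding reachable_apath by blast
  have p': "awalk u p v" "distinct (pawalk_verts u p)"
    using p by (simp_all add: apath_def)
  have sub: "set p \<subseteq> parcs G"
    using p'(1) by (simp add: awalk_def)
  have "parcs G \<subseteq> arcs underlying"
    by (auto simp: parcs_mk_symmetric)
  then have walk: "pre_digraph.awalk underlying u p v"
    using p'(1) by (auto simp: pre_digraph.awalk_def cas_with_proj_eq)
  have "(u, w) \<in> (parcs G)\<^sup>*" if "w \<in> set (pawalk_verts u p)" for w
    using awalk_verts_reachable_from[OF p'(1) that] by (simp add: reachable_conv)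
  then show ?thesis
    by (rule that[OF walk p'(2) _ sub])
qed

text \<open>
  A directed cycle is also an undirected one, and its length is at least 3 because there are neither
  loops nor opposite arcs.
\<close>

lemma (in directed_tree) arcs_acyclic: "acyclic (parcs G)"
proof (rule acyclicI, intro allI notI)
  fix u assume "(u, u) \<in> (parcs G)\<^sup>+"
  then obtain v where uv: "(u, v) \<in> parcs G" and vu: "(v, u) \<in> (parcs G)\<^sup>*"
    by (meson tranclD)
  interpret S: pair_wf_digraph "mk_symmetric (with_proj G)" ..
  obtain p where p: "S.awalk v p u" "distinct (pawalk_verts v p)" "set p \<subseteq> parcs G"
    by (rule reachable_path[OF vu in_arcsD2[OF uv]])
  have "S.cycle ((u, v) # p)"
    using p uv unfolding S.cycle_def
    by (intro exI[of _ u]) (auto simp: S.awalk_Cons_iff parcs_mk_symmetric)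
  moreover have "3 \<le> length ((u, v) # p)"
  proof (rule ccontr)
    assume "\<not> 3 \<le> length ((u, v) # p)"
    then have "p = [] \<or> (\<exists>e. p = [e])"
      by (cases p; cases "tl p") auto
    then show False
    proof
      assume "p = []"
      then have "u = v"
        using p(1) by (simp add: S.awalk_Nil_iff)
      then show False
        using uv no_loops' by blast
    next
      assume "\<exists>e. p = [e]"
      then have "(v, u) \<in> parcs G"
        using p(1,3) by (auto simp: S.awalk_Cons_iff S.awalk_Nil_iff)
      then show False
        using oriented[OF uv] by blast
    qed
  qed
  ultimately show False
    using underlying_acyclic by blast
qed

text \<open>
  The arc \<open>(u, v)\<close>, the arc \<open>(u, w)\<close> and the path from \<open>w\<close> to \<open>v\<close> would form an undirected cycle. It
  is simple because the path cannot come back to \<open>u\<close>.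
\<close>

lemma (in directed_tree) no_bypass:
  assumes "(u, w) \<in> parcs G" "(u, v) \<in> parcs G"
  shows "(w, v) \<notin> (parcs G)\<^sup>+"
proof
  assume wv: "(w, v) \<in> (parcs G)\<^sup>+"
  interpret S: pair_wf_digraph "mk_symmetric (with_proj G)" ..
  have no_return: "(w, u) \<notin> (parcs G)\<^sup>*"
    using arcs_acyclic assms(1) by (meson acyclic_def rtrancl_into_trancl2)
  obtain p where p: "S.awalk w p v" "distinct (pawalk_verts w p)"
      "\<And>x. x \<in> set (pawalk_verts w p) \<Longrightarrow> (w, x) \<in> (parcs G)\<^sup>*"
    by (rule reachable_path[OF trancl_into_rtrancl[OF wv] in_arcsD2[OF assms(1)]]) blast
  have "w \<noteq> v"
    using wv arcs_acyclic by (auto simp: acyclic_def)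
  then have "p \<noteq> []"
    using p(1) by (auto simp: S.awalk_Nil_iff)
  have arcs: "(u, w) \<in> parcs (mk_symmetric (with_proj G))" "(v, u) \<in> parcs (mk_symmetric (with_proj G))"
    using bexI[OF _ assms(1)] bexI[OF _ assms(2)] by (simp_all add: parcs_mk_symmetric)
  have return: "S.awalk v [(v, u)] u"
    using arcs(2) S.in_arcsD1 S.in_arcsD2 by (auto simp: S.awalk_Cons_iff S.awalk_Nil_iff)
  have walk: "S.awalk w (p @ [(v, u)]) u"
    using p(1) return by (rule S.awalk_appendI)
  have "pawalk_verts w (p @ [(v, u)]) = pawalk_verts w p @ [u]"
    using S.awalk_verts_append[OF walk] p(1) by simp
  moreover have "u \<notin> set (pawalk_verts w p)"
    using p(3) no_return by blast
  ultimately have "S.cycle ((u, w) # p @ [(v, u)])"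
    using walk p(1) arcs(1) p(2) unfolding S.cycle_def
    by (intro exI[of _ u]) (simp add: S.awalk_Cons_iff)
  moreover have "3 \<le> length ((u, w) # p @ [(v, u)])"
    using \<open>p \<noteq> []\<close> by (cases p) auto
  ultimately show False
    using underlying_acyclic by blast
qed

text \<open>
  The ends of an arc are comparable, and comparability is transitive in a union of chains, so it
  spreads along undirected paths.
\<close>

lemma (in directed_tree) chains_imp_comparable:
  assumes chains: "union_of_chains ((parcs G)\<^sup>+) (pverts G)" and uv: "u \<in> pverts G" "v \<in> pverts G"
  shows "comparable ((parcs G)\<^sup>+) u v"
proof -
  interpret S: pair_wf_digraph "mk_symmetric (with_proj G)" ..
  have "u \<rightarrow>\<^sup>*\<^bsub>underlying\<^esub> v"
    using underlying_connected uv by (auto simp: connected_def)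
  then show ?thesis
  proof (induction rule: S.reachable_induct)
    case (step x y)
    have arc: "(x, y) \<in> parcs G \<or> (y, x) \<in> parcs G"
      using step(2) by (auto simp: parcs_mk_symmetric)
    then have "x \<in> pverts G" "y \<in> pverts G"
      by (auto dest: in_arcsD1 in_arcsD2)
    moreover have "comparable ((parcs G)\<^sup>+) x y"
      using arc by (auto simp: comparable_def)
    ultimately show ?case
      using union_of_chainsD[OF chains uv(1)] step by blast
  qed simp
qed

text \<open>
  A path between two neighbours in the linear order of reachability has no room for an inner vertex, so
  neighbours are joined by an arc, and \<open>no_bypass\<close> excludes all longer arcs.
\<close>

lemma (in directed_tree) chains_imp_directed_path:
  assumes chains: "union_of_chains ((parcs G)\<^sup>+) (pverts G)"
  shows "directed_path G"
proof -
  let ?r = "(parcs G)\<^sup>+"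
  have irrefl: "irrefl ?r"
    using arcs_acyclic by (simp add: acyclic_irrefl)
  obtain vs where vs: "distinct vs" "set vs = pverts G"
    and "\<forall>i<length vs. \<forall>j<length vs. (vs ! i, vs ! j) \<in> ?r \<longleftrightarrow> i < j"
    by (rule linear_order_list[OF finite_verts trans_trancl irrefl chains_imp_comparable[OF chains]])
  then have order: "(vs ! i, vs ! j) \<in> ?r \<longleftrightarrow> i < j" if "i < length vs" "j < length vs" for i j
    using that by blast
  have vert: "\<exists>i < length vs. v = vs ! i" if "v \<in> pverts G" for v
    using that vs(2) by (metis in_set_conv_nth)
  have arc_verts: "u \<in> pverts G" "v \<in> pverts G" if "(u, v) \<in> parcs G" for u v
    using that by (auto dest: in_arcsD1 in_arcsD2)
  have consecutive: "(vs ! i, vs ! Suc i) \<in> parcs G" if i: "Suc i < length vs" for i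
  proof -
    have "(vs ! i, vs ! Suc i) \<in> ?r"
      using order i by simp
    then obtain w where w: "(vs ! i, w) \<in> parcs G" "(w, vs ! Suc i) \<in> (parcs G)\<^sup>*"
      by (meson tranclD)
    obtain k where k: "k < length vs" "w = vs ! k"
      using vert arc_verts(2)[OF w(1)] by blast
    have "i < k"
      using order[of i k] i k w(1) by auto
    moreover have "w = vs ! Suc i \<or> k < Suc i"
      using w(2) order[OF k(1) i] k(2) by (auto simp: rtrancl_eq_or_trancl)
    ultimately show ?thesis
      using w(1) by auto
  qed
  have "parcs G = {(vs ! i, vs ! Suc i) | i. Suc i < length vs}"
  proof
    show "{(vs ! i, vs ! Suc i) | i. Suc i < length vs} \<subseteq> parcs G"
      using consecutive by blast
    show "parcs G \<subseteq> {(vs ! i, vs ! Suc i) | i. Suc i < length vs}"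
    proof clarify
      fix u v assume uv: "(u, v) \<in> parcs G"
      obtain i j where ij: "i < length vs" "u = vs ! i" "j < length vs" "v = vs ! j"
        using vert arc_verts[OF uv] by metis
      have "i < j"
        using order[OF ij(1,3)] uv ij by auto
      have "j = Suc i"
      proof (rule ccontr)
        assume "j \<noteq> Suc i"
        then have "Suc i < j"
          using \<open>i < j\<close> by simp
        then have "(vs ! Suc i, v) \<in> ?r" "(u, vs ! Suc i) \<in> parcs G"
          using order[of "Suc i" j] consecutive[of i] ij by auto
        then show False
          using no_bypass uv by blast
      qed
      then show "\<exists>i. (u, v) = (vs ! i, vs ! Suc i) \<and> Suc i < length vs"
        using ij by blast
    qed
  qed
  moreover have "vs \<noteq> []"
    using underlying_connected vs(2) by (auto simp: connected_def strongly_connected_def)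
  ultimately show ?thesis
    unfolding directed_path_def using vs by (intro exI[of _ vs] conjI) simp_all
qed

text \<open>
  The highest possible exponent of \<open>q\<close> is reached when every arc is an ascent. Colors are shifted by
  one because variables are numbered from 1.
\<close>

lemma (in directed_tree) card_colorings_eq_coeff:
  "int (card (colorings_of_type ((parcs G)\<^sup>+) (pverts G) m))
     = coeff (chromatic_quasisymmetric G (image_mset Suc m)) (card (parcs G))"
proof -
  let ?V = "pverts G" and ?r = "(parcs G)\<^sup>+"
  let ?K = "{\<kappa>. \<kappa> \<in> proper_colorings G \<and> coloring_monomial G \<kappa> = image_mset Suc m}"
  let ?A = "{\<kappa> \<in> ?K. asc G \<kappa> = card (parcs G)}"
  have finV: "finite ?V"
    using finite_verts by simp
  have finK: "finite ?K"
    by (rule finite_colorings_with_monomial[OF finV])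
  have asc: "asc G \<kappa> = card (parcs G) \<longleftrightarrow> (\<forall>(u, v) \<in> parcs G. \<kappa> u < \<kappa> v)" for \<kappa>
  proof
    have fin: "finite (parcs G)"
      using finite_arcs by simp
    assume "asc G \<kappa> = card (parcs G)"
    then have "{(u, v) \<in> parcs G. \<kappa> u < \<kappa> v} = parcs G"
      unfolding asc_def by (intro card_subset_eq[OF fin]) auto
    then show "\<forall>(u, v) \<in> parcs G. \<kappa> u < \<kappa> v"
      by blast
  next
    assume "\<forall>(u, v) \<in> parcs G. \<kappa> u < \<kappa> v"
    then have "{(u, v) \<in> parcs G. \<kappa> u < \<kappa> v} = parcs G"
      by blast
    then show "asc G \<kappa> = card (parcs G)"
      by (simp add: asc_def)
  qed
  have arc_verts: "u \<in> ?V" "v \<in> ?V" if "(u, v) \<in> parcs G" for u v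
    using that by (auto dest: in_arcsD1 in_arcsD2)
  have path: "\<kappa> u < \<kappa> v" if "\<forall>(u, v) \<in> parcs G. \<kappa> u < \<kappa> v" "(u, v) \<in> ?r" for \<kappa> :: "'a \<Rightarrow> nat" and u v
    using that(2,1) by (induction rule: trancl_induct) fastforce+
  have "bij_betw (\<lambda>\<kappa>. restrict (\<lambda>v. Suc (\<kappa> v)) ?V) (colorings_of_type ?r ?V m) ?A"
  proof (rule bij_betw_byWitness[where f' = "\<lambda>\<kappa>. restrict (\<lambda>v. \<kappa> v - 1) ?V"])
    show "\<forall>\<kappa>\<in>colorings_of_type ?r ?V m. restrict (\<lambda>v. restrict (\<lambda>v. Suc (\<kappa> v)) ?V v - 1) ?V = \<kappa>"
      by (auto simp: colorings_of_type_def increasing_colorings_def PiE_iff extensional_def restrict_def fun_eq_iff)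
    show "\<forall>\<kappa>\<in>?A. restrict (\<lambda>v. Suc (restrict (\<lambda>v. \<kappa> v - 1) ?V v)) ?V = \<kappa>"
      by (auto simp: proper_colorings_def PiE_iff extensional_def restrict_def fun_eq_iff)
    show "(\<lambda>\<kappa>. restrict (\<lambda>v. Suc (\<kappa> v)) ?V) ` colorings_of_type ?r ?V m \<subseteq> ?A"
    proof (rule image_subsetI)
      fix \<kappa> assume \<kappa>: "\<kappa> \<in> colorings_of_type ?r ?V m"
      let ?\<kappa> = "restrict (\<lambda>v. Suc (\<kappa> v)) ?V"
      have less: "\<forall>(u, v) \<in> parcs G. ?\<kappa> u < ?\<kappa> v"
        using increasing_coloringsD[OF colorings_of_typeD(1)[OF \<kappa>]] arc_verts by fastforce
      then have "?\<kappa> \<in> proper_colorings G"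
        by (fastforce simp: proper_colorings_def)
      moreover have "coloring_monomial G ?\<kappa> = image_mset Suc m"
        using colorings_of_typeD(2)[OF \<kappa>] type_on_restrict[OF finV, of "\<lambda>v. Suc (\<kappa> v)"]
        by (simp add: coloring_monomial_def type_on_def[symmetric] type_on_comp)
      ultimately show "?\<kappa> \<in> ?A"
        using less asc by blast
    qed
    show "(\<lambda>\<kappa>. restrict (\<lambda>v. \<kappa> v - 1) ?V) ` ?A \<subseteq> colorings_of_type ?r ?V m"
    proof (rule image_subsetI)
      fix \<kappa> assume \<kappa>: "\<kappa> \<in> ?A"
      then have less: "\<forall>(u, v) \<in> parcs G. \<kappa> u < \<kappa> v"
        using asc by blast
      have pos: "\<kappa> v \<ge> 1" if "v \<in> ?V" for v
        using \<kappa> that by (auto simp: proper_colorings_def)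
      have "restrict (\<lambda>v. \<kappa> v - 1) ?V \<in> increasing_colorings ?r ?V"
      proof (rule restrict_increasing)
        fix u v assume "u \<in> ?V" "v \<in> ?V" "(u, v) \<in> ?r"
        then show "\<kappa> u - 1 < \<kappa> v - 1"
          using path[OF less] pos[of u] by fastforce
      qed
      moreover have "type_on ?V (\<lambda>v. \<kappa> v - 1) = m"
      proof -
        have "type_on ?V \<kappa> = image_mset Suc m"
          using \<kappa> by (simp add: coloring_monomial_def type_on_def)
        then show ?thesis
          using type_on_comp[of ?V "\<lambda>x. x - 1" \<kappa>] by (simp add: multiset.map_comp comp_def)
      qed
      ultimately show "restrict (\<lambda>v. \<kappa> v - 1) ?V \<in> colorings_of_type ?r ?V m"
        using finV by (simp add: colorings_of_type_def)
    qed
  qed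
  then have "card (colorings_of_type ?r ?V m) = card ?A"
    by (rule bij_betw_same_card)
  moreover have "coeff (chromatic_quasisymmetric G (image_mset Suc m)) (card (parcs G))
      = (\<Sum>\<kappa>\<in>?K. if asc G \<kappa> = card (parcs G) then 1 else 0)"
    by (simp add: chromatic_quasisymmetric_def coeff_sum)
  moreover have "\<dots> = int (card ?A)"
    using finK by (subst sum.inter_filter[symmetric]) simp_all
  ultimately show ?thesis
    by (simp only:)
qed

lemma (in directed_tree) symmetric_imp_symmetric_poset:
  assumes "symmetric_series (chromatic_quasisymmetric G)"
  shows "symmetric_poset ((parcs G)\<^sup>+) (pverts G)"
  unfolding symmetric_poset_def
proof (intro allI impI)
  fix \<sigma> :: "nat \<Rightarrow> nat" and m assume \<sigma>: "bij \<sigma>"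
  let ?\<sigma> = "case_nat 0 (\<lambda>n. Suc (\<sigma> n))"
  have "?\<sigma> permutes {1..}"
    using bij_case_nat_Suc[OF \<sigma>] by (auto simp: permutes_def bij_iff split: nat.split)
  moreover have "image_mset Suc (image_mset \<sigma> m) = image_mset ?\<sigma> (image_mset Suc m)"
    by (simp add: multiset.map_comp comp_def)
  ultimately have "int (card (colorings_of_type ((parcs G)\<^sup>+) (pverts G) (image_mset \<sigma> m)))
      = int (card (colorings_of_type ((parcs G)\<^sup>+) (pverts G) m))"
    using assms by (simp only: card_colorings_eq_coeff symmetric_series_def)
  then show "card (colorings_of_type ((parcs G)\<^sup>+) (pverts G) (image_mset \<sigma> m))
      = card (colorings_of_type ((parcs G)\<^sup>+) (pverts G) m)"
    by simp
qed

lemma (in directed_tree) symmetric_imp_directed_path: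
  assumes "symmetric_series (chromatic_quasisymmetric G)"
  shows "directed_path G"
proof (rule chains_imp_directed_path, rule symmetric_poset_union_of_chains)
  show "irrefl ((parcs G)\<^sup>+)"
    using arcs_acyclic by (simp add: acyclic_irrefl)
  show "finite (pverts G)"
    using finite_verts by simp
  show "symmetric_poset ((parcs G)\<^sup>+) (pverts G)"
    using assms by (rule symmetric_imp_symmetric_poset)
qed (rule trans_trancl)

theorem corollary1p7:
  fixes T :: "'a pair_pre_digraph"
  assumes "directed_tree T"
  shows "symmetric_series (chromatic_quasisymmetric T) \<longleftrightarrow> directed_path T"
  using directed_tree.symmetric_imp_directed_path[OF assms] directed_path_symmetric by blast

end
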